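(* Let $\omega_a:\Lambda(x\|a)\to\Lambda(x\|a')$ be the $\mathbb Q[a]$-linear ring isomorphism with $\omega_a:e_k(x\|a)\mapsto h_k(x\|a')$ for $k=1,2,\dots$. Then for every partition $\lambda$ $$\omega_a:s_\lambda(x\|a)\mapsto s_{\lambda'}(x\|a'),$$ where $\lambda'$ is the conjugate partition.
   Context: Let $a=(a_i)_{i\in\mathbb Z}$ be a sequence of commuting indeterminates and $\mathbb Q[a]$ the polynomial ring in the $a_i$. Let $a'$ be the sequence with $(a')_i=-a_{-i+1}$, $i\in\mathbb Z$; $\mathbb Q[a']$ is identified with $\mathbb Q[a]$ by replacing each $(a')_i$ with $-a_{-i+1}$. The ring $\Lambda(x\|a)$: its elements are sequences $P=(P_0,P_1,P_2,\dots)$, where $P_n$ is a symmetric polynomial in $x_1,\dots,x_n$ with coefficients in $\mathbb Q[a]$, the total degrees of the $P_n$ in the $x_i$ are bounded, and $P_n(x_1,\dots,x_{n-1},a_n)=P_{n-1}(x_1,\dots,x_{n-1})$ for all $n\geqslant 1$; multiplication is componentwise. $\Lambda(x\|a')$ is the same construction with $a'$ in place of $a$. Double Schur functions: for a partition $\lambda$ with $\ell(\lambda)\leqslant n$, $$s_\lambda(x_1,\dots,x_n\|a)=\frac{\det\big[(x_i\|a)^{\lambda_j+n-j}\big]_{i,j=1}^n}{\prod_{1\leqslant i<j\leqslant n}(x_i-x_j)},\qquad (x_i\|a)^r=(x_i-a_n)(x_i-a_{n-1})\cdots(x_i-a_{n-r+1}),\ (x_i\|a)^0=1,$$ and $0$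 if $\ell(\lambda)>n$. This sequence is $s_\lambda(x\|a)\in\Lambda(x\|a)$. Put $e_k(x\|a)=s_{(1^k)}(x\|a)$ and $h_k(x\|a)=s_{(k)}(x\|a)$. Each of the families $(e_k(x\|a))_{k\geqslant 1}$, $(h_k(x\|a))_{k\geqslant 1}$ is a set of algebraically independent generators of $\Lambda(x\|a)$ over $\mathbb Q[a]$, so $\omega_a$ is well defined. *)

theory Defs
  imports
    "HOL-Library.Poly_Mapping"
    "HOL-Library.More_List"
    "HOL-Combinatorics.Permutations"
    "HOL-Algebra.QuotRing"
    "Jordan_Normal_Form.Determinant"
begin

text \<open>
  Polynomials are finitely supported maps from monomials to coefficients, with the convolution
  product of \<^theory>\<open>HOL-Library.Poly_Mapping\<close>; a monomial is a finitely supported exponent map.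
  Type \<open>qa\<close> is the ring of rational polynomials in the indeterminates \<open>a\<^sub>i\<close>, for all integers \<open>i\<close>,
  and \<open>xpoly\<close> is the ring of polynomials over \<open>qa\<close> in \<open>x\<^sub>0, x\<^sub>1, x\<^sub>2, \<dots>\<close>, where \<open>x\<^sub>0\<close> is never used.
\<close>

type_synonym qa = "(int \<Rightarrow>\<^sub>0 nat) \<Rightarrow>\<^sub>0 rat"
type_synonym xpoly = "(nat \<Rightarrow>\<^sub>0 nat) \<Rightarrow>\<^sub>0 qa"

definition avar :: "int \<Rightarrow> qa"
  where "avar i = Poly_Mapping.single (Poly_Mapping.single i 1) 1"

text \<open>
  The identification of the polynomial rings in \<open>a'\<close> and in \<open>a\<close> is built in: the sequence \<open>a'\<close>
  is \<open>dual_seq avar\<close>, a sequence of elements of \<open>qa\<close>. Everything below is therefore defined for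
  an arbitrary sequence \<open>b\<close> in \<open>qa\<close>.
\<close>

definition dual_seq :: "(int \<Rightarrow> qa) \<Rightarrow> int \<Rightarrow> qa"
  where "dual_seq b i = - b (1 - i)"

definition xvar :: "nat \<Rightarrow> xpoly"
  where "xvar i = Poly_Mapping.single (Poly_Mapping.single i 1) 1"

definition xconst :: "qa \<Rightarrow> xpoly"
  where "xconst c = Poly_Mapping.single 0 c"

definition xsubst :: "(nat \<Rightarrow> xpoly) \<Rightarrow> xpoly \<Rightarrow> xpoly"
  where "xsubst \<sigma> p =
    (\<Sum>m \<in> Poly_Mapping.keys p.
       xconst (Poly_Mapping.lookup p m) *
       (\<Prod>i \<in> Poly_Mapping.keys m. \<sigma> i ^ Poly_Mapping.lookup m i))"

definition poly_in_vars :: "nat \<Rightarrow> xpoly \<Rightarrow> bool"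
  where "poly_in_vars n p \<longleftrightarrow> (\<forall>m \<in> Poly_Mapping.keys p. Poly_Mapping.keys m \<subseteq> {1..n})"

definition symmetric_poly :: "nat \<Rightarrow> xpoly \<Rightarrow> bool"
  where "symmetric_poly n p \<longleftrightarrow>
    poly_in_vars n p \<and> (\<forall>\<pi>. \<pi> permutes {1..n} \<longrightarrow> xsubst (\<lambda>i. xvar (\<pi> i)) p = p)"

definition xdegree_le :: "nat \<Rightarrow> xpoly \<Rightarrow> bool"
  where "xdegree_le d p \<longleftrightarrow>
    (\<forall>m \<in> Poly_Mapping.keys p. (\<Sum>i \<in> Poly_Mapping.keys m. Poly_Mapping.lookup m i) \<le> d)"

definition Lambda :: "(int \<Rightarrow> qa) \<Rightarrow> (nat \<Rightarrow> xpoly) ring"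
  where "Lambda b = \<lparr>
    carrier = {P. (\<forall>n. symmetric_poly n (P n)) \<and>
                  (\<exists>d. \<forall>n. xdegree_le d (P n)) \<and>
                  (\<forall>n\<ge>1. xsubst (xvar(n := xconst (b (int n)))) (P n) = P (n - 1))},
    monoid.mult = (\<lambda>P Q n. P n * Q n),
    one = (\<lambda>n. 1),
    zero = (\<lambda>n. 0),
    add = (\<lambda>P Q n. P n + Q n)\<rparr>"

definition Lambda_scale :: "qa \<Rightarrow> (nat \<Rightarrow> xpoly) \<Rightarrow> nat \<Rightarrow> xpoly"
  where "Lambda_scale c P n = xconst c * P n"

text \<open>A partition is the weakly decreasing list of its nonzero parts.\<close>

definition is_partition :: "nat list \<Rightarrow> bool"
  where "is_partition lam \<longleftrightarrow> sorted_wrt (\<ge>) lam \<and> 0 \<notin> set lam"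

definition conj_partition :: "nat list \<Rightarrow> nat list"
  where "conj_partition lam =
    map (\<lambda>j. length (filter (\<lambda>p. j \<le> p) lam)) [1..<Suc (if lam = [] then 0 else hd lam)]"

text \<open>The factorial power of \<open>x\<^sub>i\<close>; it depends on the number \<open>n\<close> of variables.\<close>

definition xpower :: "(int \<Rightarrow> qa) \<Rightarrow> nat \<Rightarrow> nat \<Rightarrow> nat \<Rightarrow> xpoly"
  where "xpower b n i r = (\<Prod>k<r. xvar i - xconst (b (int n - int k)))"

definition vandermonde :: "nat \<Rightarrow> xpoly"
  where "vandermonde n = (\<Prod>(i, j) \<in> {(i, j). 1 \<le> i \<and> i < j \<and> j \<le> n}. xvar i - xvar j)"

text \<open>
  Matrix indices start at 0, so entry \<open>(i, j)\<close> here is entry \<open>(i + 1, j + 1)\<close> in the usual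
  numbering, and \<open>nth_default 0 lam j\<close> is the part number \<open>j + 1\<close>, or 0 beyond the length.
  The numerator is divisible by the Vandermonde product, and \<open>xpoly\<close> is an integral domain,
  so the description operator picks the exact quotient.
\<close>

definition double_schur :: "(int \<Rightarrow> qa) \<Rightarrow> nat list \<Rightarrow> nat \<Rightarrow> xpoly"
  where "double_schur b lam n =
    (if length lam \<le> n then
       (THE p. p * vandermonde n =
          det (mat n n (\<lambda>(i, j). xpower b n (Suc i) (nth_default 0 lam j + (n - Suc j)))))
     else 0)"

definition double_e :: "(int \<Rightarrow> qa) \<Rightarrow> nat \<Rightarrow> nat \<Rightarrow> xpoly"
  where "double_e b k = double_schur b (replicate k 1)"

text \<open>The case distinction is needed because \<open>[0]\<close> is not the list of a partition.\<close>

definition double_h :: "(int \<Rightarrow> qa) \<Rightarrow> nat \<Rightarrow> nat \<Rightarrow> xpoly"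
  where "double_h b k = double_schur b (if k = 0 then [] else [k])"

end

theory Submission
  imports Defs "Jordan_Normal_Form.Char_Poly"
begin

text \<open>
  Both sides are the same determinant, with the \<open>e\<^sub>k(x\<parallel>a)\<close> in one and the \<open>h\<^sub>k(x\<parallel>a')\<close> in the other
  (two Jacobi-Trudi formulas), and \<open>\<omega>\<^sub>a\<close> carries determinants to determinants. Dividing the bialternant
  by the Vandermonde product turns its entries into divided differences of the factorial powers at the
  nodes \<open>x\<^sub>n, \<dots>, x\<^sub>1\<close>. Multiplying the rows by a unitriangular matrix yields the formula in the \<open>h\<^sub>k\<close>.
  The formula in the \<open>e\<^sub>k\<close> is Jacobi's theorem on complementary minors, applied to the change of
  basis between the Newton polynomials with nodes \<open>a\<^sub>n, a\<^bsub>n-1\<^esub>, \<dots>\<close> and those with nodes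
  \<open>x\<^sub>n, \<dots>, x\<^sub>1, a\<^sub>0, a\<^bsub>-1\<^esub>, \<dots>\<close>; the complement of the row set given by \<open>\<lambda>\<close> is given by \<open>\<lambda>'\<close>.
  The coefficients of the two formulas agree because divided differences are symmetric in their nodes
  and \<open>(a')\<^sub>i = - a\<^bsub>1-i\<^esub>\<close> is the effect of the reflection \<open>t \<mapsto> -t\<close>.
\<close>

section \<open>Newton polynomials and divided differences\<close>

definition newton :: "(nat \<Rightarrow> 'a::comm_ring_1) \<Rightarrow> nat \<Rightarrow> 'a poly"
  where "newton c k = (\<Prod>l<k. [:- c l, 1:])"

text \<open>The divided difference of \<open>g\<close> at the nodes \<open>c 0, ..., c k\<close>.
  Repeated synthetic division replaces the usual quotients, so nothing has to be invertible and
  nodes may coincide.\<close>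

primrec ndiff :: "(nat \<Rightarrow> 'a::comm_ring_1) \<Rightarrow> 'a poly \<Rightarrow> nat \<Rightarrow> 'a"
  where
    "ndiff c g 0 = poly g (c 0)"
  | "ndiff c g (Suc k) = ndiff (\<lambda>l. c (Suc l)) (synthetic_div g (c 0)) k"

declare ndiff.simps(2) [simp del]

text \<open>Division with remainder by a monic linear polynomial is unique over any commutative
  ring, so one decomposition of \<open>g\<close> determines both parts.\<close>

lemma synthetic_div_eqI:
  fixes g :: "'a::comm_ring_1 poly"
  assumes "g = [:r:] + [:-c, 1:] * q"
  shows "poly g c = r" "synthetic_div g c = q"
proof -
  have "g + smult c q = pCons r q"
    unfolding assms by simp
  from synthetic_div_unique[OF this] show "poly g c = r" "synthetic_div g c = q"
    by auto
qed

lemma synthetic_div_linear: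
  fixes g h :: "'a::comm_ring_1 poly"
  shows "synthetic_div (g + h) c = synthetic_div g c + synthetic_div h c"
    and "synthetic_div (smult a g) c = smult a (synthetic_div g c)"
proof -
  show "synthetic_div (g + h) c = synthetic_div g c + synthetic_div h c"
  proof (rule synthetic_div_eqI(2))
    show "g + h = [:poly g c + poly h c:] +
        [:-c, 1:] * (synthetic_div g c + synthetic_div h c)"
      by (subst (1 2) synthetic_div_correct'[of c, symmetric]) (simp add: algebra_simps)
  qed
  show "synthetic_div (smult a g) c = smult a (synthetic_div g c)"
  proof (rule synthetic_div_eqI(2))
    show "smult a g = [:a * poly g c:] + [:-c, 1:] * smult a (synthetic_div g c)"
    proof -
      have "smult a g = smult a ([:-c, 1:] * synthetic_div g c + [:poly g c:])"
        by (simp only: synthetic_div_correct')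
      also have "\<dots> = [:a * poly g c:] + [:-c, 1:] * smult a (synthetic_div g c)"
        by (simp only: smult_add_right mult_smult_right) simp
      finally show ?thesis .
    qed
  qed
qed

lemma ndiff_add: "ndiff c (g + h) k = ndiff c g k + ndiff c h k"
  by (induction k arbitrary: c g h) (simp_all add: ndiff.simps synthetic_div_linear)

lemma ndiff_smult: "ndiff c (smult a g) k = a * ndiff c g k"
  by (induction k arbitrary: c g) (simp_all add: ndiff.simps synthetic_div_linear)

lemma ndiff_0 [simp]: "ndiff c 0 k = 0"
  using ndiff_smult[of c 0 0 k] by simp

lemma ndiff_sum: "ndiff c (\<Sum>i\<in>I. g i) k = (\<Sum>i\<in>I. ndiff c (g i) k)"
  by (induction I rule: infinite_finite_induct) (simp_all add: ndiff_add)

lemma ndiff_cong: "(\<And>l. l \<le> k \<Longrightarrow> c l = c' l) \<Longrightarrow> ndiff c g k = ndiff c' g k"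
proof (induction k arbitrary: c c' g)
  case (Suc k)
  from Suc.prems[of 0] have "c 0 = c' 0" by simp
  with Suc.IH[of "\<lambda>l. c (Suc l)" "\<lambda>l. c' (Suc l)"] Suc.prems show ?case
    by (simp add: ndiff.simps)
qed simp

lemma newton_0 [simp]: "newton c 0 = 1"
  by (simp add: newton_def)

lemma newton_Suc: "newton c (Suc k) = [:- c k, 1:] * newton c k"
  by (simp add: newton_def mult.commute)

lemma newton_cong: "(\<And>l. l < k \<Longrightarrow> c l = c' l) \<Longrightarrow> newton c k = newton c' k"
  by (simp add: newton_def)

lemma newton_Suc_shift: "newton c (Suc k) = [:- c 0, 1:] * newton (\<lambda>l. c (Suc l)) k"
  by (simp only: newton_def prod.lessThan_Suc_shift)

lemma newton_add: "newton c (m + k) = newton c m * newton (\<lambda>l. c (m + l)) k"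
  by (induction k) (simp_all add: newton_Suc mult_ac)

lemma newton_rev: "newton (\<lambda>l. c (k - Suc l)) k = newton c k"
  unfolding newton_def by (rule prod.nat_diff_reindex)

lemma poly_newton: "poly (newton c k) x = (\<Prod>l<k. x - c l)"
  by (simp add: newton_def poly_prod)

lemma monic_newton: "degree (newton c k) \<le> k \<and> coeff (newton c k) k = 1"
proof (induction k)
  case (Suc k)
  have "degree (newton c (Suc k)) \<le> degree [:- c k, 1:] + degree (newton c k)"
    unfolding newton_Suc by (rule degree_mult_le)
  with Suc have "degree (newton c (Suc k)) \<le> Suc k" by simp
  moreover have "coeff (newton c (Suc k)) (Suc k) = 1"
    using Suc by (simp add: newton_Suc coeff_eq_0)
  ultimately show ?case by blast
qed simp

lemma degree_newton [simp]: "degree (newton c k) = k"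
  and coeff_newton_self [simp]: "coeff (newton c k) k = 1"
  using monic_newton[of c k] le_degree[of "newton c k" k] by auto

lemma ndiff_linear_mult:
  "ndiff c ([:- c 0, 1:] * g) k = (if k = 0 then 0 else ndiff (\<lambda>l. c (Suc l)) g (k - 1))"
proof (cases k)
  case (Suc k')
  have "synthetic_div ([:- c 0, 1:] * g) (c 0) = g"
    by (rule synthetic_div_eqI[of _ 0]) simp
  with Suc show ?thesis by (simp only: ndiff.simps) simp
qed simp

text \<open>The first \<open>m\<close> synthetic divisions strip the Newton factor with remainder 0
  and leave the shifted nodes for \<open>g\<close>.\<close>

lemma ndiff_newton_mult:
  "ndiff c (newton c m * g) k = (if k < m then 0 else ndiff (\<lambda>l. c (m + l)) g (k - m))"
proof (induction m arbitrary: c k)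
  case (Suc m)
  have "ndiff c (newton c (Suc m) * g) k =
      ndiff c ([:- c 0, 1:] * (newton (\<lambda>l. c (Suc l)) m * g)) k"
    by (simp only: newton_Suc_shift mult.assoc)
  also have "\<dots> = (if k = 0 then 0 else ndiff (\<lambda>l. c (Suc l)) (newton (\<lambda>l. c (Suc l)) m * g) (k - 1))"
    by (rule ndiff_linear_mult)
  finally show ?case
    by (auto simp: Suc.IH)
qed simp

text \<open>Newton interpolation with remainder: \<open>K\<close> successive synthetic divisions,
  unrolled.\<close>

lemma ndiff_expansion:
  "\<exists>q. g = (\<Sum>k<K. smult (ndiff c g k) (newton c k)) + newton c K * q"
proof (induction K arbitrary: c g)
  case 0
  show ?case by (intro exI[of _ g]) simp
next
  case (Suc K)
  define h where "h = synthetic_div g (c 0)"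
  obtain q where q: "h = (\<Sum>k<K. smult (ndiff (\<lambda>l. c (Suc l)) h k) (newton (\<lambda>l. c (Suc l)) k)) +
      newton (\<lambda>l. c (Suc l)) K * q"
    using Suc.IH by blast
  have "g = [:- c 0, 1:] * h + [:poly g (c 0):]"
    by (simp only: h_def synthetic_div_correct')
  also have "[:- c 0, 1:] * h = (\<Sum>k<K. smult (ndiff c g (Suc k)) (newton c (Suc k))) +
      newton c (Suc K) * q"
    by (subst q) (simp only: distrib_left sum_distrib_left newton_Suc_shift ndiff.simps h_def
        mult_smult_right mult.assoc)
  also have "\<dots> + [:poly g (c 0):] =
      (\<Sum>k<Suc K. smult (ndiff c g k) (newton c k)) + newton c (Suc K) * q"
    unfolding sum.lessThan_Suc_shift by simp
  finally show ?case by blast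
qed

text \<open>Synthetic division lowers a positive degree by one and sends constants to 0, so nothing
  is left after \<open>K\<close> steps.\<close>

lemma ndiff_expansion_degree:
  "degree g < K \<Longrightarrow> g = (\<Sum>k<K. smult (ndiff c g k) (newton c k))"
proof (induction K arbitrary: c g)
  case (Suc K)
  define h where "h = synthetic_div g (c 0)"
  have h: "[:- c 0, 1:] * h = (\<Sum>k<K. smult (ndiff c g (Suc k)) (newton c (Suc k)))"
  proof (cases "degree g = 0")
    case True
    then have h0: "h = 0" by (simp add: h_def synthetic_div_eq_0_iff)
    then have "ndiff c g (Suc k) = 0" for k
      by (simp add: ndiff.simps h_def[symmetric])
    with h0 show ?thesis by simp
  next
    case False
    then have "degree h < K" using Suc.prems by (simp add: h_def degree_synthetic_div)
    from Suc.IH[OF this, of "\<lambda>l. c (Suc l)"]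
    have "[:- c 0, 1:] * h = [:- c 0, 1:] *
        (\<Sum>k<K. smult (ndiff (\<lambda>l. c (Suc l)) h k) (newton (\<lambda>l. c (Suc l)) k))"
      by simp
    also have "\<dots> = (\<Sum>k<K. smult (ndiff c g (Suc k)) (newton c (Suc k)))"
      by (simp only: sum_distrib_left newton_Suc_shift ndiff.simps h_def mult_smult_right)
    finally show ?thesis .
  qed
  have "g = [:- c 0, 1:] * h + [:poly g (c 0):]"
    by (simp only: h_def synthetic_div_correct')
  also have "\<dots> = (\<Sum>k<Suc K. smult (ndiff c g k) (newton c k))"
    unfolding sum.lessThan_Suc_shift h by simp
  finally show ?case .
qed simp

text \<open>Divided differences are the coordinate functionals of the Newton basis: the case of
  cofactor 1 in \<open>ndiff_newton_mult\<close>.\<close>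

lemma ndiff_newton: "ndiff c (newton c m) k = (if k = m then 1 else 0)"
proof -
  have one: "ndiff c 1 k = (if k = 0 then 1 else 0)" for c :: "nat \<Rightarrow> 'a" and k
  proof (cases k)
    case (Suc k')
    have "synthetic_div 1 (c 0) = 0" by (simp add: synthetic_div_eq_0_iff)
    with Suc show ?thesis by (simp add: ndiff.simps)
  qed simp
  show ?thesis using ndiff_newton_mult[of c m 1 k] by (auto simp: one)
qed

lemma coeff_sum_newton:
  "coeff (\<Sum>l<Suc k. smult (\<alpha> l) (newton c l)) k = \<alpha> k"
proof -
  have "coeff (\<Sum>l<k. smult (\<alpha> l) (newton c l)) k = 0"
    by (simp add: coeff_sum coeff_eq_0)
  then show ?thesis by simp
qed

text \<open>In the Newton expansion up to order \<open>k\<close> only the last term reaches degree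
  \<open>k\<close>, and its Newton polynomial is monic. In particular the difference vanishes if
  \<open>g\<close> has degree below \<open>k\<close>.\<close>

lemma ndiff_degree_le:
  assumes "degree g \<le> k"
  shows "ndiff c g k = coeff g k"
  by (subst (2) ndiff_expansion_degree[of g "Suc k" c])
    (use assms in \<open>simp_all only: coeff_sum_newton le_imp_less_Suc\<close>)

lemma degree_sum_newton: "degree (\<Sum>l<Suc k. smult (\<alpha> l) (newton c l)) \<le> k"
  by (intro degree_sum_le) (auto intro: order_trans[OF degree_smult_le])

text \<open>A divided difference only depends on the multiset of its nodes: it is the top coefficient of
  the remainder modulo the product of the linear factors.\<close>

lemma ndiff_nodes_cong:
  fixes c c' :: "nat \<Rightarrow> 'a::idom"
  assumes "newton c (Suc k) = newton c' (Suc k)"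
  shows "ndiff c g k = ndiff c' g k"
proof -
  define r where "r c = (\<Sum>l<Suc k. smult (ndiff c g l) (newton c l))" for c
  obtain q where q: "g = r c + newton c (Suc k) * q"
    using ndiff_expansion[where g = g and K = "Suc k" and c = c] unfolding r_def by blast
  obtain q' where q': "g = r c' + newton c' (Suc k) * q'"
    using ndiff_expansion[where g = g and K = "Suc k" and c = c'] unfolding r_def by blast
  from q q' have eq: "r c - r c' = newton c (Suc k) * (q' - q)"
    using assms by (simp add: algebra_simps)
  have "degree (r c - r c') \<le> k"
    unfolding r_def by (intro degree_diff_le degree_sum_newton)
  moreover have "newton c (Suc k) \<noteq> 0"
    using coeff_newton_self[of c "Suc k"] by (metis coeff_0 zero_neq_one)
  ultimately have "q' - q = 0"
    unfolding eq by (metis Suc_n_not_le_n degree_mult_eq degree_newton le_add1 le_trans)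
  with eq have "coeff (r c) k = coeff (r c') k" by simp
  then show ?thesis by (simp only: r_def coeff_sum_newton)
qed

lemma ndiff_rev:
  fixes c :: "nat \<Rightarrow> 'a::idom"
  shows "ndiff (\<lambda>l. c (k - l)) g k = ndiff c g k"
  by (rule ndiff_nodes_cong) (use newton_rev[of c "Suc k"] in simp)

text \<open>Under \<open>t -> -t\<close> a linear factor with node \<open>c\<close> becomes minus
  the one with node \<open>-c\<close>; each synthetic division contributes one such sign.\<close>

lemma ndiff_reflect:
  "ndiff (\<lambda>l. - c l) (pcompose g [:0, -1:]) k = (-1) ^ k * ndiff c g k"
proof (induction k arbitrary: c g)
  case (Suc k)
  define h where "h = synthetic_div g (c 0)"
  have "g = [:- c 0, 1:] * h + [:poly g (c 0):]"
    by (simp only: h_def synthetic_div_correct')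
  then have "pcompose g [:0, -1:] =
      pcompose [:- c 0, 1:] [:0, -1:] * pcompose h [:0, -1:] + pcompose [:poly g (c 0):] [:0, -1:]"
    by (metis (no_types) pcompose_add pcompose_mult)
  also have "\<dots> = [:poly g (c 0):] + [:- (- c 0), 1:] * (- pcompose h [:0, -1:])"
    by (simp add: pcompose_pCons)
  finally have "synthetic_div (pcompose g [:0, -1:]) (- c 0) = smult (-1) (pcompose h [:0, -1:])"
    by (simp add: synthetic_div_eqI)
  then have "ndiff (\<lambda>l. - c l) (pcompose g [:0, -1:]) (Suc k) =
      -1 * ndiff (\<lambda>l. - c (Suc l)) (pcompose h [:0, -1:]) k"
    by (simp only: ndiff.simps ndiff_smult)
  then show ?case
    by (simp add: ndiff.simps Suc.IH h_def)
qed (simp add: poly_pcompose)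

lemma (in comm_ring_hom) hom_synthetic_div:
  "synthetic_div (map_poly hom g) (hom c) = map_poly hom (synthetic_div g c)"
proof -
  interpret p: map_poly_comm_ring_hom hom ..
  have "g = [:poly g c:] + [:-c, 1:] * synthetic_div g c"
    by (metis synthetic_div_correct' add.commute)
  then have "map_poly hom g = map_poly hom ([:poly g c:] + [:-c, 1:] * synthetic_div g c)"
    by simp
  also have "\<dots> = [:hom (poly g c):] + [:- hom c, 1:] * map_poly hom (synthetic_div g c)"
    by (simp only: p.hom_add p.hom_mult) (simp add: hom_distribs)
  finally show ?thesis by (rule synthetic_div_eqI)
qed

lemma (in comm_ring_hom) hom_ndiff:
  "hom (ndiff c g k) = ndiff (\<lambda>l. hom (c l)) (map_poly hom g) k"
  by (induction k arbitrary: c g) (simp_all add: ndiff.simps hom_synthetic_div)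

lemma (in comm_ring_hom) hom_newton:
  "map_poly hom (newton c k) = newton (\<lambda>l. hom (c l)) k"
proof -
  interpret p: map_poly_comm_ring_hom hom ..
  show ?thesis by (simp add: newton_def p.hom_prod hom_distribs)
qed

section \<open>Determinants and complementary minors\<close>

lemma det_upper_triangular_prod:
  assumes "\<And>i j. j < i \<Longrightarrow> i < n \<Longrightarrow> f i j = 0"
  shows "det (mat n n (\<lambda>(i, j). f i j)) = (\<Prod>i<n. f i i)"
proof -
  let ?A = "mat n n (\<lambda>(i, j). f i j)"
  have "det ?A = prod_list (diag_mat ?A)"
    using assms by (intro det_upper_triangular[of _ n]) auto
  also have "\<dots> = (\<Prod>i<n. f i i)"
    by (simp add: prod_list_diag_prod atLeast0LessThan)
  finally show ?thesis .
qed

lemma det_lower_triangular_prod: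
  assumes "\<And>i j. i < j \<Longrightarrow> j < n \<Longrightarrow> f i j = 0"
  shows "det (mat n n (\<lambda>(i, j). f i j)) = (\<Prod>i<n. f i i)"
proof -
  let ?A = "mat n n (\<lambda>(i, j). f i j)"
  have "det ?A = prod_list (diag_mat ?A)"
    using assms by (intro det_lower_triangular[of n]) auto
  also have "\<dots> = (\<Prod>i<n. f i i)"
    by (simp add: prod_list_diag_prod atLeast0LessThan)
  finally show ?thesis .
qed

lemma det_mat_transpose:
  "det (mat n n (\<lambda>(i, j). f j i)) = det (mat n n (\<lambda>(i, j). f i j))"
proof -
  have "mat n n (\<lambda>(i, j). f j i) = transpose_mat (mat n n (\<lambda>(i, j). f i j))"
    by auto
  then show ?thesis by (simp add: det_transpose[of _ n])
qed

lemma det_mat_mult: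
  "det (mat n n (\<lambda>(i, j). \<Sum>k<n. f i k * g k j)) =
    det (mat n n (\<lambda>(i, j). f i j)) * det (mat n n (\<lambda>(i, j). g i j))"
proof -
  have "mat n n (\<lambda>(i, j). \<Sum>k<n. f i k * g k j) =
      mat n n (\<lambda>(i, j). f i j) * mat n n (\<lambda>(i, j). g i j)"
    by (auto simp: scalar_prod_def atLeast0LessThan)
  then show ?thesis by (simp add: det_mult[of _ n])
qed

lemma det_mat_permute_rows:
  assumes "p permutes {..<n}"
  shows "det (mat n n (\<lambda>(i, j). f (p i) j)) = of_int (sign p) * det (mat n n (\<lambda>(i, j). f i j))"
proof -
  have "p i < n" if "i < n" for i
    using permutes_in_image[OF assms, of i] that by simp
  then have "mat n n (\<lambda>(i, j). f (p i) j) =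
      mat n n (\<lambda>(i, j). mat n n (\<lambda>(i, j). f i j) $$ (p i, j))"
    by auto
  then show ?thesis
    using assms by (simp add: det_permute_rows[of _ n] atLeast0LessThan)
qed

lemma det_mat_permute_cols:
  assumes "p permutes {..<n}"
  shows "det (mat n n (\<lambda>(i, j). f i (p j))) = of_int (sign p) * det (mat n n (\<lambda>(i, j). f i j))"
  using det_mat_permute_rows[OF assms, of "\<lambda>i j. f j i"]
  by (simp add: det_mat_transpose[of n "\<lambda>j i. f i (p j)"] det_mat_transpose[of n f])

lemma det_block_upper_right_zero:
  fixes f :: "nat \<Rightarrow> nat \<Rightarrow> 'a::idom"
  assumes "\<And>i j. i < n \<Longrightarrow> j < m \<Longrightarrow> f i (n + j) = 0"
  shows "det (mat (n + m) (n + m) (\<lambda>(i, j). f i j)) =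
    det (mat n n (\<lambda>(i, j). f i j)) * det (mat m m (\<lambda>(i, j). f (n + i) (n + j)))"
proof -
  let ?A = "mat n n (\<lambda>(i, j). f i j)" and ?D = "mat m m (\<lambda>(i, j). f (n + i) (n + j))"
    and ?C = "mat m n (\<lambda>(i, j). f (n + i) j)"
  have "mat (n + m) (n + m) (\<lambda>(i, j). f i j) = four_block_mat ?A (0\<^sub>m n m) ?C ?D"
    using assms by (intro eq_matI) (auto simp: le_iff_add not_less)
  then show ?thesis by (simp add: det_four_block_mat_upper_right_zero[of _ n _ m])
qed

lemma det_block_lower_left_zero:
  fixes f :: "nat \<Rightarrow> nat \<Rightarrow> 'a::idom"
  assumes "\<And>i j. i < m \<Longrightarrow> j < n \<Longrightarrow> f (n + i) j = 0"
  shows "det (mat (n + m) (n + m) (\<lambda>(i, j). f i j)) =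
    det (mat n n (\<lambda>(i, j). f i j)) * det (mat m m (\<lambda>(i, j). f (n + i) (n + j)))"
  using det_block_upper_right_zero[of n m "\<lambda>i j. f j i"] assms
  by (simp add: det_mat_transpose[of _ f] det_mat_transpose[of _ "\<lambda>i j. f (n + i) (n + j)"])

lemma det_mat_scale:
  fixes f :: "nat \<Rightarrow> nat \<Rightarrow> 'a::comm_ring_1"
  shows "det (mat n n (\<lambda>(i, j). \<alpha> i * \<beta> j * f i j)) =
    (\<Prod>i<n. \<alpha> i) * (\<Prod>j<n. \<beta> j) * det (mat n n (\<lambda>(i, j). f i j))"
proof -
  let ?a = "\<lambda>i k. if i = k then \<alpha> i else 0" and ?b = "\<lambda>k j. if k = j then \<beta> j else 0"
  have "det (mat n n (\<lambda>(i, j). \<alpha> i * \<beta> j * f i j)) =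
      det (mat n n (\<lambda>(i, j). \<Sum>k<n. ?a i k * (\<Sum>l<n. f k l * ?b l j)))"
    by (intro arg_cong[of _ _ det] eq_matI)
      (auto simp: if_distrib[of "(*) _"] if_distrib[of "\<lambda>x. x * _"] mult_ac cong: if_cong)
  also have "\<dots> = (\<Prod>i<n. \<alpha> i) * (det (mat n n (\<lambda>(i, j). f i j)) * (\<Prod>j<n. \<beta> j))"
    by (simp only: det_mat_mult) (simp add: det_upper_triangular_prod)
  finally show ?thesis by (simp add: mult_ac)
qed

text \<open>Newton interpolation at the points \<open>x\<close> themselves factors the matrix of
  values. The nodes run backwards so that the matrix of Newton values is upper triangular; its
  diagonal multiplies to the Vandermonde product.\<close>

lemma det_poly_points:
  fixes x :: "nat \<Rightarrow> 'a::idom"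
  shows "det (mat n n (\<lambda>(i, j). poly (g j) (x i))) =
    (\<Prod>(i, j)\<in>{(i, j). i < j \<and> j < n}. x i - x j) *
    det (mat n n (\<lambda>(i, j). ndiff (\<lambda>l. x (n - Suc l)) (g j) (n - Suc i)))"
proof -
  define y where "y = (\<lambda>l. x (n - Suc l))"
  have root: "poly (newton y k) (x i) = 0" if "i < n" "n - Suc i < k" for i k
  proof -
    have "y (n - Suc i) = x i" using that by (simp add: y_def)
    with that(2) show ?thesis by (auto simp: poly_newton intro!: bexI[of _ "n - Suc i"])
  qed
  have "poly (g j) (x i) =
      (\<Sum>k<n. poly (newton y (n - Suc k)) (x i) * ndiff y (g j) (n - Suc k))" if "i < n" for i j
  proof -
    obtain q where "g j = (\<Sum>k<n. smult (ndiff y (g j) k) (newton y k)) + newton y n * q"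
      using ndiff_expansion by blast
    then have "poly (g j) (x i) =
        poly ((\<Sum>k<n. smult (ndiff y (g j) k) (newton y k)) + newton y n * q) (x i)"
      by simp
    also have "\<dots> = (\<Sum>k<n. poly (newton y k) (x i) * ndiff y (g j) k)"
      using root[OF that, of n] that by (simp add: poly_sum mult.commute)
    finally show ?thesis
      using sum.nat_diff_reindex[of "\<lambda>k. poly (newton y k) (x i) * ndiff y (g j) k" n] by simp
  qed
  then have "det (mat n n (\<lambda>(i, j). poly (g j) (x i))) =
      det (mat n n (\<lambda>(i, j). \<Sum>k<n. poly (newton y (n - Suc k)) (x i) * ndiff y (g j) (n - Suc k)))"
    by (intro arg_cong[of _ _ det] eq_matI) auto
  also have "\<dots> = det (mat n n (\<lambda>(i, j). poly (newton y (n - Suc j)) (x i))) *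
      det (mat n n (\<lambda>(i, j). ndiff y (g j) (n - Suc i)))"
    by (rule det_mat_mult)
  also have "det (mat n n (\<lambda>(i, j). poly (newton y (n - Suc j)) (x i))) =
      (\<Prod>i<n. poly (newton y (n - Suc i)) (x i))"
    by (rule det_upper_triangular_prod) (auto intro: root)
  also have "\<dots> = (\<Prod>i<n. \<Prod>j\<in>{i<..<n}. x i - x j)"
  proof (rule prod.cong)
    fix i assume "i \<in> {..<n}"
    then show "poly (newton y (n - Suc i)) (x i) = (\<Prod>j\<in>{i<..<n}. x i - x j)"
      unfolding poly_newton y_def
      by (intro prod.reindex_bij_witness[of _ "\<lambda>j. n - Suc j" "\<lambda>l. n - Suc l"]) auto
  qed simp
  also have "\<dots> = (\<Prod>(i, j)\<in>{(i, j). i < j \<and> j < n}. x i - x j)"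
    by (subst prod.Sigma) (auto intro!: prod.cong)
  finally show ?thesis by (simp add: y_def)
qed

text \<open>Jacobi's theorem on complementary minors of an inverse matrix: multiplying the permuted
  matrix by the one with an identity block and the complementary columns of the inverse leaves a
  block triangular matrix.\<close>

lemma det_complementary_minor:
  fixes A B :: "nat \<Rightarrow> nat \<Rightarrow> 'a::idom"
  assumes inv: "\<And>i k. i < n + m \<Longrightarrow> k < n + m \<Longrightarrow>
      (\<Sum>j<n + m. A i j * B j k) = (if i = k then 1 else 0)"
    and det: "det (mat (n + m) (n + m) (\<lambda>(i, j). A i j)) = 1"
    and p: "p permutes {..<n + m}" and q: "q permutes {..<n + m}"
  shows "det (mat n n (\<lambda>(i, j). A (p i) (q j))) =
    of_int (sign p * sign q) * det (mat m m (\<lambda>(i, j). B (q (n + i)) (p (n + j))))"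
proof -
  let ?N = "n + m"
  let ?A = "\<lambda>i j. A (p i) (q j)"
  let ?X = "\<lambda>i j. if j < n then if i = j then 1 else 0 else B (q i) (p j)"
  let ?Y = "\<lambda>i j. if j < n then A (p i) (q j) else if i = j then 1 else 0"
  have "(\<Sum>k<?N. ?A i k * ?X k j) = ?Y i j" if "i < ?N" "j < ?N" for i j
  proof (cases "j < n")
    case True
    then show ?thesis by (auto simp: if_distrib[of "(*) _"] cong: if_cong)
  next
    case False
    then have "(\<Sum>k<?N. ?A i k * ?X k j) = (\<Sum>k<?N. A (p i) (q k) * B (q k) (p j))"
      by simp
    also have "\<dots> = (\<Sum>k<?N. A (p i) k * B k (p j))"
      using sum.permute[OF q, of "\<lambda>k. A (p i) k * B k (p j)"] by (simp add: o_def)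
    also have "\<dots> = (if p i = p j then 1 else 0)"
      using that permutes_in_image[OF p] by (intro inv) auto
    finally show ?thesis
      using False by (simp add: inj_eq[OF permutes_inj[OF p]])
  qed
  then have "det (mat ?N ?N (\<lambda>(i, j). ?Y i j)) =
      det (mat ?N ?N (\<lambda>(i, j). \<Sum>k<?N. ?A i k * ?X k j))"
    by (intro arg_cong[of _ _ det] eq_matI) auto
  also have "\<dots> = det (mat ?N ?N (\<lambda>(i, j). ?A i j)) * det (mat ?N ?N (\<lambda>(i, j). ?X i j))"
    by (rule det_mat_mult)
  also have "det (mat ?N ?N (\<lambda>(i, j). ?A i j)) = of_int (sign p * sign q)"
    by (subst det_mat_permute_rows[OF p, of "\<lambda>i j. A i (q j)"],
        subst det_mat_permute_cols[OF q, of A]) (simp add: det)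
  also have "det (mat ?N ?N (\<lambda>(i, j). ?X i j)) =
      det (mat n n (\<lambda>(i, j). ?X i j)) * det (mat m m (\<lambda>(i, j). ?X (n + i) (n + j)))"
    by (rule det_block_lower_left_zero) simp
  also have "det (mat n n (\<lambda>(i, j). ?X i j)) = 1"
    by (subst det_upper_triangular_prod) auto
  also have "det (mat ?N ?N (\<lambda>(i, j). ?Y i j)) =
      det (mat n n (\<lambda>(i, j). ?Y i j)) * det (mat m m (\<lambda>(i, j). ?Y (n + i) (n + j)))"
    by (rule det_block_upper_right_zero) simp
  also have "det (mat m m (\<lambda>(i, j). ?Y (n + i) (n + j))) = 1"
    by (subst det_upper_triangular_prod) auto
  finally have "det (mat n n (\<lambda>(i, j). ?Y i j)) =
      of_int (sign p * sign q) * det (mat m m (\<lambda>(i, j). ?X (n + i) (n + j)))"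
    by simp
  moreover have "mat n n (\<lambda>(i, j). ?Y i j) = mat n n (\<lambda>(i, j). A (p i) (q j))"
    by auto
  ultimately show ?thesis by simp
qed

section \<open>Conjugate partitions and Maya diagrams\<close>

definition conj_part :: "nat \<Rightarrow> (nat \<Rightarrow> nat) \<Rightarrow> nat \<Rightarrow> nat"
  where "conj_part n lam j = card {i. i < n \<and> j < lam i}"

text \<open>The Maya diagram of a partition in an \<open>n \<times> m\<close> box: the first \<open>n\<close> values are the beads, the
  last \<open>m\<close> values are the gaps. Adding a box to the partition exchanges a bead with the gap above it,
  which gives the sign of this permutation.\<close>

definition maya :: "nat \<Rightarrow> nat \<Rightarrow> (nat \<Rightarrow> nat) \<Rightarrow> nat \<Rightarrow> nat"
  where "maya n m lam i =
    (if i < n then lam i + (n - Suc i)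
     else if i < n + m then i - conj_part n lam (i - n) else i)"

lemma conj_part_le: "conj_part n lam j \<le> n"
proof -
  have "conj_part n lam j \<le> card {..<n}"
    unfolding conj_part_def by (rule card_mono) auto
  then show ?thesis by simp
qed

lemma maya_zero: "maya n m (\<lambda>_. 0) i = (if i < n then n - Suc i else i)"
  by (simp add: maya_def conj_part_def)

text \<open>Induction on the number of boxes. The counts by rows and by columns both drop by one
  with each removed box, so their equality comes from the same induction. The sign for the empty
  diagram stays unevaluated, as it cancels later.\<close>

lemma maya_sign:
  assumes "antimono lam" "\<And>i. lam i \<le> m" "\<And>i. n \<le> i \<Longrightarrow> lam i = 0"
  shows "maya n m lam permutes {..<n + m} \<and>
    sign (maya n m lam) = (-1) ^ (\<Sum>i<n. lam i) * sign (maya n m (\<lambda>_. 0)) \<and>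
    (\<Sum>j<m. conj_part n lam j) = (\<Sum>i<n. lam i)"
  using assms
proof (induction "\<Sum>i<n. lam i" arbitrary: lam)
  case 0
  then have lam: "lam = (\<lambda>_. 0)"
    by (intro ext) (metis finite_lessThan lessThan_iff not_less sum_eq_0_iff)
  \<comment> \<open>The empty diagram reverses the first \<open>n\<close> positions and fixes the
    rest, so it is its own inverse.\<close>
  have "bij_betw (maya n m lam) {..<n + m} {..<n + m}"
    unfolding lam by (rule bij_betwI[where g = "maya n m (\<lambda>_. 0)"]) (auto simp: maya_zero)
  moreover have "maya n m lam i = i" if "i \<notin> {..<n + m}" for i
    using that unfolding lam by (simp add: maya_zero)
  ultimately have "maya n m lam permutes {..<n + m}"
    by (rule bij_imp_permutes)
  then show ?case by (simp add: lam conj_part_def)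
next
  case (Suc S)
  \<comment> \<open>The lowest nonempty row: removing its last box leaves a partition.\<close>
  define r where "r = Max {i. i < n \<and> 0 < lam i}"
  have "{i. i < n \<and> 0 < lam i} \<noteq> {}"
  proof
    assume *: "{i. i < n \<and> 0 < lam i} = {}"
    have "(\<Sum>i<n. lam i) = 0"
      by (rule sum.neutral) (use * in auto)
    with Suc.hyps(2) show False by simp
  qed
  then have "r \<in> {i. i < n \<and> 0 < lam i}"
    unfolding r_def by (intro Max_in) auto
  then have r: "r < n" "0 < lam r" by auto
  have above: "lam i = 0" if "r < i" for i
  proof (cases "i < n")
    case True
    have "i \<notin> {i. i < n \<and> 0 < lam i}"
      using that Max_ge[of "{i. i < n \<and> 0 < lam i}" i] by (fastforce simp: r_def)
    with True show ?thesis by simp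
  qed (use Suc.prems(3) in simp)
  define c where "c = lam r - 1"
  have c: "lam r = Suc c" "c < m"
    using r(2) Suc.prems(2)[of r] by (auto simp: c_def)
  define mu where "mu = lam(r := c)"
  have mono: "lam r \<le> lam i" if "i \<le> r" for i
    using Suc.prems(1) that by (rule antimonoD)
  have sum_lam: "(\<Sum>i<n. lam i) = Suc (\<Sum>i<n. mu i)"
  proof -
    have "(\<Sum>i<n. lam i) = lam r + (\<Sum>i\<in>{..<n} - {r}. lam i)"
      using r(1) by (intro sum.remove) auto
    moreover have "(\<Sum>i<n. mu i) = mu r + (\<Sum>i\<in>{..<n} - {r}. mu i)"
      using r(1) by (intro sum.remove) auto
    moreover have "(\<Sum>i\<in>{..<n} - {r}. mu i) = (\<Sum>i\<in>{..<n} - {r}. lam i)"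
      by (intro sum.cong) (auto simp: mu_def)
    ultimately show ?thesis by (simp add: mu_def c)
  qed
  have "antimono mu"
  proof (rule antimonoI)
    fix i j :: nat assume "i \<le> j"
    then show "mu j \<le> mu i"
      using antimonoD[OF Suc.prems(1), of i j] above[of j] mono[of i] c by (auto simp: mu_def)
  qed
  moreover have "mu i \<le> m" for i
    using Suc.prems(2)[of i] c by (simp add: mu_def)
  moreover have "mu i = 0" if "n \<le> i" for i
    using Suc.prems(3)[of i] that r(1) by (simp add: mu_def)
  ultimately have IH: "maya n m mu permutes {..<n + m}"
      "sign (maya n m mu) = (-1) ^ (\<Sum>i<n. mu i) * sign (maya n m (\<lambda>_. 0))"
      "(\<Sum>j<m. conj_part n mu j) = (\<Sum>i<n. mu i)"
    using Suc.hyps sum_lam by auto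
  have conj_c: "conj_part n lam c = Suc r" "conj_part n mu c = r"
  proof -
    have "{i. i < n \<and> c < lam i} = {..<Suc r}"
      using r(1) c(1) mono above by (auto simp: less_Suc_eq_le not_less[symmetric])
    then show "conj_part n lam c = Suc r" by (simp add: conj_part_def)
    have "{i. i < n \<and> c < mu i} = {..<r}"
      using r(1) c(1) mono above
      by (auto simp: mu_def less_Suc_eq_le Suc_le_eq)
        (metis less_nat_zero_code linorder_neqE_nat)+
    then show "conj_part n mu c = r" by (simp add: conj_part_def)
  qed
  have conj_other: "conj_part n lam j = conj_part n mu j" if "j \<noteq> c" for j
    unfolding conj_part_def using that c(1)
    by (intro arg_cong[of _ _ card]) (auto simp: mu_def less_Suc_eq split: if_splits)
  have sum_conj: "(\<Sum>j<m. conj_part n lam j) = Suc (\<Sum>j<m. conj_part n mu j)"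
  proof -
    have "(\<Sum>j<m. conj_part n lam j) = conj_part n lam c + (\<Sum>j\<in>{..<m} - {c}. conj_part n lam j)"
      using c(2) by (intro sum.remove) auto
    moreover have "(\<Sum>j<m. conj_part n mu j) =
        conj_part n mu c + (\<Sum>j\<in>{..<m} - {c}. conj_part n mu j)"
      using c(2) by (intro sum.remove) auto
    moreover have "(\<Sum>j\<in>{..<m} - {c}. conj_part n mu j) =
        (\<Sum>j\<in>{..<m} - {c}. conj_part n lam j)"
      by (intro sum.cong) (auto simp: conj_other)
    ultimately show ?thesis by (simp add: conj_c)
  qed
  have mu_r: "mu r = c" by (simp add: mu_def)
  \<comment> \<open>\<open>v\<close> is the position of bead \<open>r\<close> without the box. The
    gap of column \<open>c\<close> is then at \<open>Suc v\<close>, and the box exchanges the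
    two.\<close>
  define v where "v = c + (n - Suc r)"
  have v: "maya n m mu r = v" "maya n m mu (n + c) = Suc v"
      "maya n m lam r = Suc v" "maya n m lam (n + c) = v"
    using r(1) c mu_r by (auto simp: maya_def v_def conj_c)
  let ?t = "transpose v (Suc v)"
  have "maya n m lam i = (?t \<circ> maya n m mu) i" for i
  proof (cases "i = r \<or> i = n + c")
    case True
    then show ?thesis by (auto simp: v)
  next
    case False
    then have "maya n m mu i \<noteq> v" "maya n m mu i \<noteq> Suc v"
      using v(1,2) inj_eq[OF permutes_inj[OF IH(1)], of i] by metis+
    moreover have "maya n m lam i = maya n m mu i"
      using False by (auto simp: maya_def mu_def conj_other)
    ultimately show ?thesis by simp
  qed
  then have eq: "maya n m lam = ?t \<circ> maya n m mu" by blast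
  have t: "?t permutes {..<n + m}"
    using c(2) r(1) by (intro permutes_swap_id) (auto simp: v_def)
  have "sign (maya n m lam) = sign ?t * sign (maya n m mu)"
    unfolding eq using t IH(1)
    by (intro sign_compose permutes_imp_permutation[of "{..<n + m}"]) auto
  then show ?case
    using IH t sum_lam sum_conj by (simp add: eq permutes_compose sign_swap_id)
qed

section \<open>Determinants of divided differences\<close>

text \<open>Expanding one Newton basis in the other and reading off coordinates in the first
  recovers the identity matrix.\<close>

lemma newton_change_inverse:
  assumes "i < N" "k < N"
  shows "(\<Sum>j<N. ndiff z (newton c i) j * ndiff c (newton z j) k) = (if i = k then 1 else 0)"
proof -
  have "newton c i = (\<Sum>j<N. smult (ndiff z (newton c i) j) (newton z j))"
    using assms(1) by (intro ndiff_expansion_degree) simp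
  then have "ndiff c (newton c i) k =
      ndiff c (\<Sum>j<N. smult (ndiff z (newton c i) j) (newton z j)) k"
    by simp
  then show ?thesis
    by (simp add: ndiff_sum ndiff_smult ndiff_newton eq_commute)
qed

text \<open>The left side is the minor of the change-of-basis matrix on the bead rows of
  \<open>lam\<close> and the columns \<open>n - 1, ..., 0\<close>. The complementary minor of the
  inverse has the rows \<open>n, n + 1, ...\<close> and the gaps as columns.\<close>

lemma det_conjugate_minor:
  fixes c z :: "nat \<Rightarrow> 'a::idom"
  assumes "antimono lam" "\<And>i. lam i \<le> m" "\<And>i. n \<le> i \<Longrightarrow> lam i = 0"
  shows "det (mat n n (\<lambda>(i, j). ndiff z (newton c (lam i + (n - Suc i))) (n - Suc j))) =
    (-1) ^ (\<Sum>i<n. lam i) *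
    det (mat m m (\<lambda>(i, j). ndiff c (newton z (n + i)) (n + j - conj_part n lam j)))"
proof -
  define p where "p = maya n m lam"
  \<comment> \<open>The diagram of the empty partition lists the columns in the required order. Its
    sign occurs twice in \<open>sign p * sign q\<close> and cancels.\<close>
  define q where "q = maya n m (\<lambda>_. 0)"
  have p: "p permutes {..<n + m}" "sign p = (-1) ^ (\<Sum>i<n. lam i) * sign q"
    using maya_sign[of lam m n] assms by (auto simp: p_def q_def)
  have q: "q permutes {..<n + m}"
    using maya_sign[of "\<lambda>_. 0" m n] by (auto simp: q_def antimono_def)
  \<comment> \<open>Newton polynomials are monic, so the change of basis is unitriangular.\<close>
  have "det (mat (n + m) (n + m) (\<lambda>(i, j). ndiff z (newton c i) j)) = 1"
    by (subst det_lower_triangular_prod) (simp_all add: ndiff_degree_le coeff_eq_0)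
  then have "det (mat n n (\<lambda>(i, j). ndiff z (newton c (p i)) (q j))) =
      of_int (sign p * sign q) *
      det (mat m m (\<lambda>(i, j). ndiff c (newton z (q (n + i))) (p (n + j))))"
    using p(1) q by (intro det_complementary_minor newton_change_inverse)
  also have "sign p * sign q = (-1) ^ (\<Sum>i<n. lam i)"
    by (simp add: p(2) mult.assoc sign_idempotent)
  also have "mat m m (\<lambda>(i, j). ndiff c (newton z (q (n + i))) (p (n + j))) =
      mat m m (\<lambda>(i, j). ndiff c (newton z (n + i)) (n + j - conj_part n lam j))"
    by (intro eq_matI) (auto simp: p_def q_def maya_zero maya_def)
  also have "mat n n (\<lambda>(i, j). ndiff z (newton c (p i)) (q j)) =
      mat n n (\<lambda>(i, j). ndiff z (newton c (lam i + (n - Suc i))) (n - Suc j))"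
    by (intro eq_matI) (auto simp: p_def q_def maya_zero maya_def)
  finally show ?thesis by simp
qed

text \<open>In \<open>n\<close> variables \<open>z\<close>, and with nodes \<open>c\<^sub>l = a\<^bsub>n - l\<^esub>\<close>, these are the double elementary and
  complete symmetric polynomials.\<close>

definition gen_e :: "(nat \<Rightarrow> 'a::comm_ring_1) \<Rightarrow> (nat \<Rightarrow> 'a) \<Rightarrow> nat \<Rightarrow> nat \<Rightarrow> 'a"
  where "gen_e c z n r = (if r \<le> n then (-1) ^ r * ndiff c (newton z n) (n - r) else 0)"

definition gen_h :: "(nat \<Rightarrow> 'a::comm_ring_1) \<Rightarrow> (nat \<Rightarrow> 'a) \<Rightarrow> nat \<Rightarrow> nat \<Rightarrow> 'a"
  where "gen_h c z n r = ndiff z (newton c (n - 1 + r)) (n - 1)"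

text \<open>The factor \<open>newton z n\<close> is expanded at the nodes \<open>c\<close>, where
  its coefficients are the \<open>gen_e\<close> up to sign. The remaining \<open>i\<close> factors
  meet shifted nodes, and \<open>s\<close> is the order of the difference left for them.\<close>

lemma ndiff_gen_e:
  fixes c z :: "nat \<Rightarrow> 'a::comm_ring_1"
  assumes "mu \<le> n"
  shows "ndiff c (newton z (n + i)) (n + j - mu) =
    (\<Sum>s | s \<le> i \<and> j \<le> mu + s. (-1) ^ (mu + s - j) * gen_e c z n (mu + s - j) *
      ndiff (\<lambda>l. c (n - (mu + s - j) + l)) (newton (\<lambda>l. z (n + l)) i) s)"
    (is "_ = sum ?R ?I")
proof -
  define K where "K = n + j - mu"
  define f where "f = newton z n"
  define u where "u = newton (\<lambda>l. z (n + l)) i"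
  have u: "ndiff d u s = 0" if "i < s" for d s
    using that by (simp add: u_def ndiff_degree_le coeff_eq_0)
  have "f = (\<Sum>k<Suc n. smult (ndiff c f k) (newton c k))"
    by (rule ndiff_expansion_degree) (simp add: f_def)
  then have "f * u = (\<Sum>k<Suc n. smult (ndiff c f k) (newton c k)) * u"
    by (rule arg_cong)
  also have "\<dots> = (\<Sum>k<Suc n. smult (ndiff c f k) (newton c k * u))"
    by (simp only: sum_distrib_right mult_smult_left)
  finally have "ndiff c (newton z (n + i)) K =
      (\<Sum>k<Suc n. ndiff c f k * (if K < k then 0 else ndiff (\<lambda>l. c (k + l)) u (K - k)))"
    by (simp only: newton_add f_def[symmetric] u_def[symmetric] ndiff_sum ndiff_smult
        ndiff_newton_mult)
  also have "\<dots> = (\<Sum>k | k \<le> n \<and> k \<le> K \<and> K - k \<le> i.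
      ndiff c f k * ndiff (\<lambda>l. c (k + l)) u (K - k))"
  proof (rule sum.mono_neutral_cong_right)
    show "\<forall>k \<in> {..<Suc n} - {k. k \<le> n \<and> k \<le> K \<and> K - k \<le> i}.
        ndiff c f k * (if K < k then 0 else ndiff (\<lambda>l. c (k + l)) u (K - k)) = 0"
    proof
      fix k assume "k \<in> {..<Suc n} - {k. k \<le> n \<and> k \<le> K \<and> K - k \<le> i}"
      then have "K < k \<or> i < K - k" by auto
      then show "ndiff c f k * (if K < k then 0 else ndiff (\<lambda>l. c (k + l)) u (K - k)) = 0"
        by (elim disjE) (simp_all add: u)
    qed
  qed auto
  also have "\<dots> = (\<Sum>s | s \<le> i \<and> j \<le> mu + s \<and> mu + s - j \<le> n. ?R s)"
  proof (rule sum.reindex_bij_witness[of _ "\<lambda>s. K - s" "\<lambda>k. K - k"])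
    fix k assume "k \<in> {k. k \<le> n \<and> k \<le> K \<and> K - k \<le> i}"
    then have k: "k \<le> n" "k \<le> K" "K - k \<le> i" by auto
    show "K - (K - k) = k" using k(2) by simp
    have r: "mu + (K - k) - j = n - k" "j \<le> mu + (K - k)"
      using k(1,2) assms by (auto simp: K_def)
    then show "K - k \<in> {s. s \<le> i \<and> j \<le> mu + s \<and> mu + s - j \<le> n}"
      using k by simp
    have "(-1) ^ (n - k) * ((-1) ^ (n - k) * a) = a" for a :: 'a
      by (simp add: mult.assoc[symmetric] flip: power_mult_distrib)
    then show "?R (K - k) = ndiff c f k * ndiff (\<lambda>l. c (k + l)) u (K - k)"
      using k(1) by (simp add: r gen_e_def f_def u_def)
  next
    fix s assume "s \<in> {s. s \<le> i \<and> j \<le> mu + s \<and> mu + s - j \<le> n}"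
    then have s: "s \<le> i" "j \<le> mu + s" "mu + s - j \<le> n" by auto
    then have "s \<le> K" "K - s \<le> n" using assms by (auto simp: K_def)
    then show "K - (K - s) = s" "K - s \<in> {k. k \<le> n \<and> k \<le> K \<and> K - k \<le> i}"
      using s by auto
  qed
  also have "\<dots> = sum ?R ?I"
    by (rule sum.mono_neutral_left) (auto simp: gen_e_def)
  finally show ?thesis by (simp add: K_def)
qed

text \<open>\<open>g\<close> is expanded at nodes that continue those of its cofactor, so every
  product is again a Newton polynomial in \<open>c\<close>, and its difference of order
  \<open>n - 1\<close> is a \<open>gen_h\<close>.\<close>

lemma ndiff_gen_h:
  fixes c z :: "nat \<Rightarrow> 'a::comm_ring_1"
  assumes "j < n" "degree g \<le> i"
  shows "ndiff z (g * newton c (mu + (n - Suc j))) (n - 1) =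
    (\<Sum>s | s \<le> i \<and> j \<le> mu + s. gen_h c z n (mu + s - j) *
      ndiff (\<lambda>l. c (mu + (n - Suc j) + l)) g s)"
    (is "_ = sum ?R ?I")
proof -
  define K where "K = mu + (n - Suc j)"
  define d where "d = (\<lambda>l. c (K + l))"
  have "g = (\<Sum>s<Suc i. smult (ndiff d g s) (newton d s))"
    using assms(2) by (intro ndiff_expansion_degree) simp
  then have "g * newton c K = (\<Sum>s<Suc i. smult (ndiff d g s) (newton d s)) * newton c K"
    by (rule arg_cong)
  also have "\<dots> = (\<Sum>s<Suc i. smult (ndiff d g s) (newton c (K + s)))"
    by (simp only: sum_distrib_right mult_smult_left newton_add d_def mult.commute[of "newton c K"])
  finally have "ndiff z (g * newton c K) (n - 1) =
      (\<Sum>s<Suc i. ndiff z (newton c (K + s)) (n - 1) * ndiff d g s)"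
    by (simp only: ndiff_sum ndiff_smult mult.commute[of "ndiff d g _"])
  also have "\<dots> = sum ?R ?I"
  proof (rule sum.mono_neutral_cong_right)
    show "\<forall>s \<in> {..<Suc i} - ?I. ndiff z (newton c (K + s)) (n - 1) * ndiff d g s = 0"
    proof
      fix s assume "s \<in> {..<Suc i} - ?I"
      \<comment> \<open>For \<open>mu + s < j\<close> the degree falls below the order
        \<open>n - 1\<close>: complete polynomials of negative index are 0.\<close>
      then have "K + s < n - 1" using assms(1) by (auto simp: K_def)
      then show "ndiff z (newton c (K + s)) (n - 1) * ndiff d g s = 0"
        by (simp add: ndiff_degree_le coeff_eq_0)
    qed
    fix s assume "s \<in> ?I"
    then have "K + s = n - 1 + (mu + s - j)"
      using assms(1) by (auto simp: K_def)
    then show "ndiff z (newton c (K + s)) (n - 1) * ndiff d g s = ?R s"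
      by (simp add: gen_h_def d_def K_def)
  qed auto
  finally show ?thesis by (simp add: K_def)
qed

text \<open>By symmetry the roots of \<open>newton x k\<close> can be taken as the first nodes and
  divided out; the surviving nodes are then reversed back.\<close>

lemma ndiff_rev_newton_mult:
  fixes x :: "nat \<Rightarrow> 'a::idom"
  assumes "k < n"
  shows "ndiff (\<lambda>l. x (n - Suc l)) (newton x k * g) (n - 1) =
    ndiff (\<lambda>l. x (n - Suc l)) g (n - Suc k)"
proof -
  have "ndiff (\<lambda>l. x (n - Suc l)) (newton x k * g) (n - 1) = ndiff x (newton x k * g) (n - 1)"
    using ndiff_rev[of x "n - 1" "newton x k * g"] by simp
  also have "\<dots> = ndiff (\<lambda>l. x (k + l)) g (n - Suc k)"
    using assms by (simp add: ndiff_newton_mult)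
  also have "\<dots> = ndiff (\<lambda>l. x (k + (n - Suc k - l))) g (n - Suc k)"
    by (rule ndiff_rev[symmetric])
  also have "\<dots> = ndiff (\<lambda>l. x (n - Suc l)) g (n - Suc k)"
    using assms by (intro ndiff_cong) (simp add: Suc_diff_Suc)
  finally show ?thesis .
qed

text \<open>The columns from \<open>m\<close> on belong to zero parts and split off a unitriangular
  block. In the remaining block a unitriangular row transformation brings all differences to the
  same order \<open>n - 1\<close>, as \<open>ndiff_gen_h\<close> requires.\<close>

lemma det_truncate:
  fixes c x :: "nat \<Rightarrow> 'a::idom"
  assumes "m \<le> n" "\<And>j. m \<le> j \<Longrightarrow> mu j = 0"
  shows "det (mat n n (\<lambda>(i, j). ndiff (\<lambda>l. x (n - Suc l)) (newton c (mu j + (n - Suc j))) (n - Suc i))) =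
    det (mat m m (\<lambda>(i, j).
      ndiff (\<lambda>l. x (n - Suc l)) (newton b i * newton c (mu j + (n - Suc j))) (n - 1)))"
proof -
  define y where "y = (\<lambda>l. x (n - Suc l))"
  let ?g = "\<lambda>j. newton c (mu j + (n - Suc j))"
  obtain d where d: "n = m + d" using assms(1) le_Suc_ex by blast
  \<comment> \<open>Here the polynomial is monic of degree \<open>n - Suc j\<close>, which is at
    most the order of the difference.\<close>
  have tail: "ndiff y (?g j) (n - Suc i) = (if i = j then 1 else 0)"
    if "i \<le> j" "m \<le> j" "j < n" for i j
    using that assms(2)[of j] by (auto simp: ndiff_degree_le coeff_eq_0)
  have "det (mat n n (\<lambda>(i, j). ndiff y (?g j) (n - Suc i))) =
      det (mat m m (\<lambda>(i, j). ndiff y (?g j) (n - Suc i))) *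
      det (mat d d (\<lambda>(i, j). ndiff y (?g (m + j)) (n - Suc (m + i))))"
    unfolding d
  proof (rule det_block_upper_right_zero)
    fix i j assume "i < m" "j < d"
    then show "ndiff y (newton c (mu (m + j) + (m + d - Suc (m + j)))) (m + d - Suc i) = 0"
      using tail[of i "m + j"] by (simp add: d)
  qed
  also have "det (mat d d (\<lambda>(i, j). ndiff y (?g (m + j)) (n - Suc (m + i)))) = 1"
  proof -
    have "ndiff y (?g (m + j)) (n - Suc (m + i)) = (if i = j then 1 else 0)"
      if "i \<le> j" "j < d" for i j
      using tail[of "m + i" "m + j"] that by (simp add: d)
    then show ?thesis
      by (subst det_lower_triangular_prod) simp_all
  qed
  \<comment> \<open>The factor 1 becomes the determinant of the change of basis from Newton
    polynomials at \<open>x\<close> to those at the free nodes \<open>b\<close>.\<close>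
  also have "det (mat m m (\<lambda>(i, j). ndiff y (?g j) (n - Suc i))) * 1 =
      det (mat m m (\<lambda>(i, j). ndiff x (newton b i) j)) *
      det (mat m m (\<lambda>(i, j). ndiff y (?g j) (n - Suc i)))"
    by (subst (2) det_lower_triangular_prod) (auto simp: ndiff_degree_le coeff_eq_0)
  also have "\<dots> = det (mat m m (\<lambda>(i, j). \<Sum>k<m. ndiff x (newton b i) k * ndiff y (?g j) (n - Suc k)))"
    by (rule det_mat_mult[symmetric])
  also have "mat m m (\<lambda>(i, j). \<Sum>k<m. ndiff x (newton b i) k * ndiff y (?g j) (n - Suc k)) =
      mat m m (\<lambda>(i, j). ndiff y (newton b i * ?g j) (n - 1))"
  proof (intro eq_matI, goal_cases)
    case (1 i j)
    then have i: "i < m" by simp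
    have "newton b i = (\<Sum>k<m. smult (ndiff x (newton b i) k) (newton x k))"
      by (rule ndiff_expansion_degree) (simp add: i)
    then have "newton b i * ?g j = (\<Sum>k<m. smult (ndiff x (newton b i) k) (newton x k)) * ?g j"
      by (rule arg_cong)
    also have "\<dots> = (\<Sum>k<m. smult (ndiff x (newton b i) k) (newton x k * ?g j))"
      by (simp only: sum_distrib_right mult_smult_left)
    finally have "ndiff y (newton b i * ?g j) (n - 1) =
        (\<Sum>k<m. ndiff x (newton b i) k * ndiff y (newton x k * ?g j) (n - 1))"
      by (simp only: ndiff_sum ndiff_smult)
    also have "\<dots> = (\<Sum>k<m. ndiff x (newton b i) k * ndiff y (?g j) (n - Suc k))"
      unfolding y_def using assms(1)
      by (intro sum.cong refl arg_cong2[where f = "(*)"] ndiff_rev_newton_mult) auto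
    finally show ?case using 1 by simp
  qed auto
  finally show ?thesis by (simp add: y_def)
qed

section \<open>Polynomials in the variables\<close>

interpretation xconst_hom: comm_ring_hom xconst
  by standard (simp_all add: xconst_def single_add mult_single single_one)

definition xmonom :: "(nat \<Rightarrow> xpoly) \<Rightarrow> (nat \<Rightarrow>\<^sub>0 nat) \<Rightarrow> xpoly"
  where "xmonom \<sigma> m = (\<Prod>i \<in> Poly_Mapping.keys m. \<sigma> i ^ Poly_Mapping.lookup m i)"

lemma xmonom_superset:
  assumes "finite I" "Poly_Mapping.keys m \<subseteq> I"
  shows "xmonom \<sigma> m = (\<Prod>i\<in>I. \<sigma> i ^ Poly_Mapping.lookup m i)"
  unfolding xmonom_def using assms
  by (intro prod.mono_neutral_left) (auto simp: in_keys_iff)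

lemma xmonom_add: "xmonom \<sigma> (m + m') = xmonom \<sigma> m * xmonom \<sigma> m'"
proof -
  let ?I = "Poly_Mapping.keys m \<union> Poly_Mapping.keys m'"
  have "xmonom \<sigma> (m + m') = (\<Prod>i\<in>?I. \<sigma> i ^ Poly_Mapping.lookup (m + m') i)"
    by (rule xmonom_superset) (auto simp: keys_add)
  also have "\<dots> = (\<Prod>i\<in>?I. \<sigma> i ^ Poly_Mapping.lookup m i) *
      (\<Prod>i\<in>?I. \<sigma> i ^ Poly_Mapping.lookup m' i)"
    by (simp add: lookup_add power_add prod.distrib)
  also have "\<dots> = xmonom \<sigma> m * xmonom \<sigma> m'"
    by (simp add: xmonom_superset[of ?I m] xmonom_superset[of ?I m'])
  finally show ?thesis .
qed

lemma xsubst_superset: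
  assumes "finite I" "Poly_Mapping.keys p \<subseteq> I"
  shows "xsubst \<sigma> p = (\<Sum>m\<in>I. xconst (Poly_Mapping.lookup p m) * xmonom \<sigma> m)"
  unfolding xsubst_def xmonom_def[symmetric] using assms
  by (intro sum.mono_neutral_left) (auto simp: in_keys_iff)

lemma xsubst_add: "xsubst \<sigma> (p + q) = xsubst \<sigma> p + xsubst \<sigma> q"
proof -
  let ?I = "Poly_Mapping.keys p \<union> Poly_Mapping.keys q"
  have "xsubst \<sigma> (p + q) = (\<Sum>m\<in>?I. xconst (Poly_Mapping.lookup (p + q) m) * xmonom \<sigma> m)"
    by (rule xsubst_superset) (auto simp: keys_add)
  also have "\<dots> = (\<Sum>m\<in>?I. xconst (Poly_Mapping.lookup p m) * xmonom \<sigma> m) +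
      (\<Sum>m\<in>?I. xconst (Poly_Mapping.lookup q m) * xmonom \<sigma> m)"
    by (simp add: lookup_add xconst_hom.hom_add distrib_right sum.distrib)
  also have "\<dots> = xsubst \<sigma> p + xsubst \<sigma> q"
    by (simp add: xsubst_superset[of ?I p] xsubst_superset[of ?I q])
  finally show ?thesis .
qed

lemma xsubst_single: "xsubst \<sigma> (Poly_Mapping.single m c) = xconst c * xmonom \<sigma> m"
  by (subst xsubst_superset[of "{m}"]) auto

lemma poly_mapping_sum_single:
  "p = (\<Sum>m \<in> Poly_Mapping.keys p. Poly_Mapping.single m (Poly_Mapping.lookup p m))"
  by (rule poly_mapping_eqI) (auto simp: lookup_sum lookup_single when_def in_keys_iff)

lemma xsubst_0 [simp]: "xsubst \<sigma> 0 = 0"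
  by (simp add: xsubst_def)

lemma xsubst_sum: "xsubst \<sigma> (\<Sum>i\<in>I. f i) = (\<Sum>i\<in>I. xsubst \<sigma> (f i))"
  by (induction I rule: infinite_finite_induct) (simp_all add: xsubst_add)

lemma xsubst_mult: "xsubst \<sigma> (p * q) = xsubst \<sigma> p * xsubst \<sigma> q"
proof -
  let ?P = "Poly_Mapping.keys p" and ?Q = "Poly_Mapping.keys q"
  let ?p = "Poly_Mapping.lookup p" and ?q = "Poly_Mapping.lookup q"
  have "p * q = (\<Sum>m\<in>?P. Poly_Mapping.single m (?p m)) * (\<Sum>m\<in>?Q. Poly_Mapping.single m (?q m))"
    by (simp flip: poly_mapping_sum_single)
  then have "xsubst \<sigma> (p * q) = (\<Sum>m\<in>?P. \<Sum>m'\<in>?Q. xconst (?p m * ?q m') * xmonom \<sigma> (m + m'))"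
    by (simp add: sum_product mult_single xsubst_sum xsubst_single)
  also have "\<dots> = xsubst \<sigma> p * xsubst \<sigma> q"
    by (simp add: xsubst_def sum_product xmonom_add xconst_hom.hom_mult mult_ac
        flip: xmonom_def)
  finally show ?thesis .
qed

lemma xsubst_xconst [simp]: "xsubst \<sigma> (xconst c) = xconst c"
  by (simp add: xconst_def[of c] xsubst_single) (simp add: xmonom_def xconst_def)

lemma xsubst_xvar [simp]: "xsubst \<sigma> (xvar i) = \<sigma> i"
  by (simp add: xvar_def xsubst_single) (simp add: xmonom_def)

interpretation xsubst_hom: comm_ring_hom "xsubst \<sigma>" for \<sigma>
proof
  show "xsubst \<sigma> 1 = 1"
    using xsubst_xconst[of \<sigma> 1] by simp
qed (simp_all add: xsubst_add xsubst_mult)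

lemma xvar_eq_iff: "xvar i = xvar j \<longleftrightarrow> i = j"
proof
  assume *: "xvar i = xvar j"
  show "i = j"
  proof (rule ccontr)
    assume "i \<noteq> j"
    have "xsubst (\<lambda>k. if k = i then 1 else 0) (xvar i) = xsubst (\<lambda>k. if k = i then 1 else 0) (xvar j)"
      by (simp add: *)
    with \<open>i \<noteq> j\<close> show False by simp
  qed
qed simp

section \<open>Bounds on variables and degrees\<close>

definition xbounded :: "nat \<Rightarrow> nat \<Rightarrow> xpoly \<Rightarrow> bool"
  where "xbounded n d p \<longleftrightarrow> poly_in_vars n p \<and> xdegree_le d p"


lemma monomial_degree_add:
  fixes m m' :: "nat \<Rightarrow>\<^sub>0 nat"
  shows "(\<Sum>i \<in> Poly_Mapping.keys (m + m'). Poly_Mapping.lookup (m + m') i) =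
    (\<Sum>i \<in> Poly_Mapping.keys m. Poly_Mapping.lookup m i) +
    (\<Sum>i \<in> Poly_Mapping.keys m'. Poly_Mapping.lookup m' i)"
proof -
  let ?I = "Poly_Mapping.keys m \<union> Poly_Mapping.keys m'"
  have superset: "(\<Sum>i \<in> Poly_Mapping.keys k. Poly_Mapping.lookup k i) = (\<Sum>i\<in>?I. Poly_Mapping.lookup k i)"
    if "Poly_Mapping.keys k \<subseteq> ?I" for k :: "nat \<Rightarrow>\<^sub>0 nat"
    using that by (intro sum.mono_neutral_left) (auto simp: in_keys_iff)
  show ?thesis
    unfolding superset[OF keys_add] superset[OF Un_upper1] superset[OF Un_upper2]
    by (simp add: lookup_add sum.distrib)
qed

lemma xbounded_add: "xbounded n d p \<Longrightarrow> xbounded n d q \<Longrightarrow> xbounded n d (p + q)"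
  using keys_add[of p q] unfolding xbounded_def poly_in_vars_def xdegree_le_def by blast

lemma xbounded_mult:
  assumes "xbounded n d p" "xbounded n e q"
  shows "xbounded n (d + e) (p * q)"
proof -
  have "Poly_Mapping.keys k \<subseteq> {1..n} \<and>
      (\<Sum>i \<in> Poly_Mapping.keys k. Poly_Mapping.lookup k i) \<le> d + e"
    if k: "k \<in> Poly_Mapping.keys (p * q)" for k
  proof -
    obtain m m' where m: "k = m + m'" "m \<in> Poly_Mapping.keys p" "m' \<in> Poly_Mapping.keys q"
      using k keys_mult[of p q] by blast
    have "Poly_Mapping.keys m \<subseteq> {1..n}" "Poly_Mapping.keys m' \<subseteq> {1..n}"
      using assms m(2,3) unfolding xbounded_def poly_in_vars_def by blast+
    then have "Poly_Mapping.keys k \<subseteq> {1..n}"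
      using keys_add[of m m'] m(1) by blast
    moreover have "(\<Sum>i \<in> Poly_Mapping.keys m. Poly_Mapping.lookup m i) \<le> d"
        "(\<Sum>i \<in> Poly_Mapping.keys m'. Poly_Mapping.lookup m' i) \<le> e"
      using assms m(2,3) unfolding xbounded_def xdegree_le_def by blast+
    ultimately show ?thesis
      by (simp add: m(1) monomial_degree_add add_mono)
  qed
  then show ?thesis
    by (auto simp: xbounded_def poly_in_vars_def xdegree_le_def)
qed

lemma xbounded_mono: "xbounded n d p \<Longrightarrow> d \<le> e \<Longrightarrow> xbounded n e p"
  unfolding xbounded_def xdegree_le_def by fastforce

lemma xbounded_xconst: "xbounded n d (xconst c)"
  by (auto simp: xbounded_def poly_in_vars_def xdegree_le_def xconst_def)

lemma xbounded_0: "xbounded n d 0"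
  using xbounded_xconst[of n d 0] by simp

lemma xbounded_1: "xbounded n d 1"
  using xbounded_xconst[of n d 1] by simp

lemma xbounded_xvar: "i \<in> {1..n} \<Longrightarrow> xbounded n 1 (xvar i)"
  by (auto simp: xbounded_def poly_in_vars_def xdegree_le_def xvar_def)

lemma xbounded_const_mult: "xbounded n d p \<Longrightarrow> xbounded n d (xconst c * p)"
  using xbounded_mult[OF xbounded_xconst[of n 0 c], of d p] by simp

lemma xbounded_uminus: "xbounded n d p \<Longrightarrow> xbounded n d (- p)"
  using xbounded_const_mult[of n d p "-1"] by (simp add: xconst_hom.hom_uminus)

lemma xbounded_sum: "(\<And>i. i \<in> I \<Longrightarrow> xbounded n d (f i)) \<Longrightarrow> xbounded n d (\<Sum>i\<in>I. f i)"
  by (induction I rule: infinite_finite_induct) (auto simp: xbounded_0 xbounded_add)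

section \<open>Double elementary symmetric polynomials as elements of \<open>Lambda\<close>\<close>

abbreviation cnode :: "(int \<Rightarrow> qa) \<Rightarrow> nat \<Rightarrow> nat \<Rightarrow> xpoly"
  where "cnode b n \<equiv> \<lambda>l. xconst (b (int n - int l))"

text \<open>Only \<open>l < n\<close> gives one of the \<open>n\<close> variables; later nodes are
  \<open>xvar 0\<close> by truncated subtraction.\<close>

abbreviation xnode :: "nat \<Rightarrow> nat \<Rightarrow> xpoly"
  where "xnode n \<equiv> \<lambda>l. xvar (n - l)"

text \<open>An explicit form of \<open>double_e\<close>, identified with it in
  \<open>double_e_eq_super_e\<close>. Degree, symmetry and stability are read off from this
  form.\<close>

definition super_e :: "(int \<Rightarrow> qa) \<Rightarrow> nat \<Rightarrow> nat \<Rightarrow> xpoly"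
  where "super_e b r n = gen_e (cnode b n) (xnode n) n r"

text \<open>Up to sign, coefficient \<open>j\<close> is the elementary symmetric polynomial of
  degree \<open>k - j\<close> in the nodes; for \<open>j > k\<close> it is 0.\<close>

lemma xbounded_coeff_newton:
  assumes "\<And>l. l < k \<Longrightarrow> xbounded n 1 (z l)"
  shows "xbounded n (k - j) (coeff (newton z k) j)"
  using assms
proof (induction k arbitrary: j)
  case 0
  then show ?case
    by (cases j) (simp_all add: xbounded_0 xbounded_1)
next
  case (Suc k)
  have IH: "xbounded n (k - j) (coeff (newton z k) j)" for j
    using Suc by simp
  have 1: "xbounded n (Suc k - j) (- z k * coeff (newton z k) j)"
  proof (cases "j \<le> k")
    case True
    then show ?thesis
      using xbounded_mult[OF xbounded_uminus[OF Suc.prems[of k]] IH[of j]] by (simp add: Suc_diff_le)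
  next
    case False
    then show ?thesis by (simp add: coeff_eq_0 xbounded_0)
  qed
  show ?case
  proof (cases j)
    case 0
    then show ?thesis using 1 by (simp add: newton_Suc)
  next
    case (Suc j')
    then show ?thesis
      using xbounded_add[OF 1, of "coeff (newton z k) j'"] IH[of j'] by (simp add: newton_Suc)
  qed
qed

lemma ndiff_cnode_const:
  "\<exists>q. ndiff (cnode b n) (monom 1 j) k = xconst q"
proof -
  have "ndiff (cnode b n) (monom 1 j) k = xconst (ndiff (\<lambda>l. b (int n - int l)) (monom 1 j) k)"
    by (simp add: xconst_hom.hom_ndiff map_poly_monom)
  then show ?thesis by blast
qed

text \<open>The difference of order \<open>n - r\<close> of a power of degree \<open>j\<close> is
  free of the variables and vanishes for \<open>j < n - r\<close>. The other coefficients of the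
  product have degree at most \<open>n - j\<close>, hence at most \<open>r\<close>.\<close>

lemma xbounded_super_e: "xbounded n r (super_e b r n)"
proof (cases "r \<le> n")
  case True
  define f where "f = newton (xnode n) n"
  have f: "xbounded n (n - j) (coeff f j)" for j
    unfolding f_def by (rule xbounded_coeff_newton, rule xbounded_xvar) auto
  have "f = (\<Sum>j\<le>n. smult (coeff f j) (monom 1 j))"
    using poly_as_sum_of_monoms[of f] by (simp add: f_def smult_monom)
  then have "ndiff (cnode b n) f (n - r) =
      ndiff (cnode b n) (\<Sum>j\<le>n. smult (coeff f j) (monom 1 j)) (n - r)"
    by (rule arg_cong)
  also have "\<dots> = (\<Sum>j\<le>n. coeff f j * ndiff (cnode b n) (monom 1 j) (n - r))"
    by (simp only: ndiff_sum ndiff_smult)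
  also have "xbounded n r \<dots>"
  proof (rule xbounded_sum)
    fix j assume "j \<in> {..n}"
    show "xbounded n r (coeff f j * ndiff (cnode b n) (monom 1 j) (n - r))"
    proof (cases "j < n - r")
      case True
      then show ?thesis
        by (simp add: ndiff_degree_le degree_monom_eq xbounded_0)
    next
      case False
      then have "xbounded n r (coeff f j)"
        using f[of j] by (rule_tac xbounded_mono) auto
      then show ?thesis
        using ndiff_cnode_const[of b n j "n - r"] xbounded_const_mult by (metis mult.commute)
    qed
  qed
  finally have "xbounded n r (ndiff (cnode b n) f (n - r))" .
  then have "xbounded n r (xconst ((-1) ^ r) * ndiff (cnode b n) f (n - r))"
    by (rule xbounded_const_mult)
  then show ?thesis
    using True by (simp add: super_e_def gen_e_def f_def hom_distribs xconst_hom.hom_uminus)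
qed (simp add: super_e_def gen_e_def xbounded_0)

lemma (in comm_ring_hom) hom_gen_e:
  "hom (gen_e c z n r) = gen_e (\<lambda>l. hom (c l)) (\<lambda>l. hom (z l)) n r"
  by (simp add: gen_e_def hom_distribs hom_ndiff hom_newton)

text \<open>The common first node is a root of \<open>newton z (Suc n)\<close>, so the first
  synthetic division removes it from both node sequences. For \<open>r = Suc n\<close> the
  difference is the value at that root.\<close>

lemma gen_e_stable:
  assumes "c 0 = z 0"
  shows "gen_e c z (Suc n) r = gen_e (\<lambda>l. c (Suc l)) (\<lambda>l. z (Suc l)) n r"
proof (cases "r \<le> n")
  case True
  have "ndiff c (newton z (Suc n)) (Suc n - r) =
      ndiff (\<lambda>l. c (Suc l)) (newton (\<lambda>l. z (Suc l)) n) (n - r)"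
    unfolding newton_Suc_shift assms[symmetric]
    using True by (subst ndiff_linear_mult) (simp add: Suc_diff_le)
  with True show ?thesis by (simp add: gen_e_def)
next
  case False
  have "ndiff c (newton z (Suc n)) 0 = 0"
    unfolding newton_Suc_shift assms[symmetric] by (subst ndiff_linear_mult) simp
  with False show ?thesis by (auto simp: gen_e_def not_le less_Suc_eq_le Suc_le_eq)
qed

lemma newton_xnode: "newton (\<lambda>l. g (n - l)) n = (\<Prod>i\<in>{1..n}. [:- g i, 1:])"
  unfolding newton_def
  by (rule prod.reindex_bij_witness[of _ "\<lambda>i. n - i" "\<lambda>l. n - l"]) auto

text \<open>The variables enter only through a product of linear factors, which a permutation
  reorders.\<close>

lemma symmetric_super_e:
  assumes "\<pi> permutes {1..n}"
  shows "xsubst (\<lambda>i. xvar (\<pi> i)) (super_e b r n) = super_e b r n"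
proof -
  have "newton (\<lambda>l. xvar (\<pi> (n - l))) n = newton (xnode n) n"
    unfolding newton_xnode[of "\<lambda>i. xvar (\<pi> i)"] newton_xnode[of xvar]
    by (subst (2) prod.permute[OF assms]) (simp add: o_def)
  then show ?thesis
    by (simp add: super_e_def xsubst_hom.hom_gen_e) (simp add: gen_e_def)
qed

text \<open>The first nodes are \<open>xvar n\<close> and the constant \<open>b (int n)\<close>; the
  substitution makes them equal, so \<open>gen_e_stable\<close> applies.\<close>

lemma super_e_stable:
  assumes "1 \<le> n"
  shows "xsubst (xvar(n := xconst (b (int n)))) (super_e b r n) = super_e b r (n - 1)"
proof -
  obtain k where n: "n = Suc k" using assms by (cases n) auto
  let ?\<sigma> = "xvar(Suc k := xconst (b (int (Suc k))))"
  have "newton (\<lambda>l. ?\<sigma> (Suc k - Suc l)) k = newton (xnode k) k"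
    by (rule newton_cong) auto
  moreover have "(\<lambda>l. cnode b (Suc k) (Suc l)) = cnode b k"
    by simp
  ultimately have eq: "gen_e (\<lambda>l. cnode b (Suc k) (Suc l)) (\<lambda>l. ?\<sigma> (Suc k - Suc l)) k r =
      gen_e (cnode b k) (xnode k) k r"
    by (simp only: gen_e_def)
  have "xsubst ?\<sigma> (super_e b r (Suc k)) =
      gen_e (cnode b (Suc k)) (\<lambda>l. ?\<sigma> (Suc k - l)) (Suc k) r"
    by (simp only: super_e_def xsubst_hom.hom_gen_e xsubst_xconst xsubst_xvar)
  also have "\<dots> = gen_e (\<lambda>l. cnode b (Suc k) (Suc l)) (\<lambda>l. ?\<sigma> (Suc k - Suc l)) k r"
    by (rule gen_e_stable) simp
  also note eq
  finally show ?thesis by (simp add: n super_e_def)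
qed

lemma super_e_in_Lambda: "super_e b r \<in> carrier (Lambda b)"
  using xbounded_super_e[of _ r b] symmetric_super_e[of _ _ b r] super_e_stable[of _ b r]
  by (auto simp: Lambda_def symmetric_poly_def xbounded_def)

section \<open>Exact division by the Vandermonde product\<close>

lemma vandermonde_nonzero: "vandermonde n \<noteq> 0"
proof -
  have "finite {(i, j). 1 \<le> i \<and> i < j \<and> j \<le> n}"
    by (rule finite_subset[of _ "{1..n} \<times> {1..n}"]) auto
  then show ?thesis
    by (auto simp: vandermonde_def xvar_eq_iff)
qed

lemma vandermonde_alt:
  "vandermonde n = (\<Prod>(i, j)\<in>{(i, j). i < j \<and> j < n}. xvar (Suc i) - xvar (Suc j))"
  unfolding vandermonde_def
  by (rule prod.reindex_bij_witness[of _ "\<lambda>(i, j). (Suc i, Suc j)" "\<lambda>(i, j). (i - 1, j - 1)"]) auto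

lemma xpower_newton: "xpower b n i r = poly (newton (cnode b n) r) (xvar i)"
  by (simp add: xpower_def poly_newton)

text \<open>\<open>det_poly_points\<close> exhibits the quotient, and cancelling the nonzero
  Vandermonde product shows that it is the only one, which justifies the description
  operator.\<close>

lemma double_schur_numerator:
  assumes "length lam \<le> n"
  shows "double_schur b lam n * vandermonde n =
    det (mat n n (\<lambda>(i, j). xpower b n (Suc i) (nth_default 0 lam j + (n - Suc j))))"
    and "double_schur b lam n = det (mat n n (\<lambda>(i, j).
      ndiff (xnode n) (newton (cnode b n) (nth_default 0 lam j + (n - Suc j))) (n - Suc i)))"
proof -
  let ?D = "det (mat n n (\<lambda>(i, j).
      ndiff (xnode n) (newton (cnode b n) (nth_default 0 lam j + (n - Suc j))) (n - Suc i)))"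
  let ?N = "det (mat n n (\<lambda>(i, j). xpower b n (Suc i) (nth_default 0 lam j + (n - Suc j))))"
  have cong: "ndiff (\<lambda>l. xvar (Suc (n - Suc l))) g (n - Suc i) = ndiff (xnode n) g (n - Suc i)"
    if "i < n" for g i
    using that by (intro ndiff_cong) (auto simp: Suc_diff_Suc)
  have "?N = vandermonde n * det (mat n n (\<lambda>(i, j). ndiff (\<lambda>l. xvar (Suc (n - Suc l)))
      (newton (cnode b n) (nth_default 0 lam j + (n - Suc j))) (n - Suc i)))"
    unfolding xpower_newton vandermonde_alt by (rule det_poly_points)
  also have "\<dots> = ?D * vandermonde n"
    by (subst mult.commute, intro arg_cong2[where f = "(*)"] arg_cong[of _ _ det] eq_matI)
      (auto simp: cong)
  finally have eq: "?D * vandermonde n = ?N" ..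
  have "double_schur b lam n = ?D"
    unfolding double_schur_def if_P[OF assms]
    using eq vandermonde_nonzero[of n] by (intro the_equality) (auto simp flip: eq)
  with eq show "double_schur b lam n = ?D" "double_schur b lam n * vandermonde n = ?N"
    by auto
qed

section \<open>Jacobi-Trudi formulas\<close>

definition super_h :: "(int \<Rightarrow> qa) \<Rightarrow> nat \<Rightarrow> nat \<Rightarrow> xpoly"
  where "super_h b r n = gen_h (cnode b n) (xnode n) n r"

text \<open>The coefficient of \<open>h\<^bsub>mu - j + s\<^esub>\<close> in entry \<open>(i, j)\<close> of the Jacobi-Trudi matrix, where \<open>mu\<close> is the
  part belonging to column \<open>j\<close>.\<close>

definition jt_coeff :: "(int \<Rightarrow> qa) \<Rightarrow> nat \<Rightarrow> nat \<Rightarrow> nat \<Rightarrow> nat \<Rightarrow> qa"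
  where "jt_coeff b mu i j s =
    ndiff (\<lambda>l. b (1 + int j - int mu - int l)) (newton (\<lambda>l. b (int l + 1)) i) s"

text \<open>The family \<open>P\<close> is a parameter because the formulas in
  \<open>double_e\<close> and in \<open>double_h\<close> share their coefficients. The lower bound
  on \<open>s\<close> expresses that members of negative index count as 0.\<close>

definition jt_entry :: "(int \<Rightarrow> qa) \<Rightarrow> (nat \<Rightarrow> nat) \<Rightarrow> (nat \<Rightarrow> nat \<Rightarrow> xpoly) \<Rightarrow> nat \<Rightarrow> nat \<Rightarrow> nat \<Rightarrow> xpoly"
  where "jt_entry b mu P i j n = (\<Sum>s | s \<le> i \<and> j \<le> mu j + s.
    Lambda_scale (jt_coeff b (mu j) i j s) (P (mu j + s - j)) n)"

definition jt_det :: "(int \<Rightarrow> qa) \<Rightarrow> nat \<Rightarrow> (nat \<Rightarrow> nat) \<Rightarrow> (nat \<Rightarrow> nat \<Rightarrow> xpoly) \<Rightarrow> nat \<Rightarrow> xpoly"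
  where "jt_det b m mu P n = det (mat m m (\<lambda>(i, j). jt_entry b mu P i j n))"

lemma jt_entry_0_0: "jt_entry b mu P 0 0 n = P (mu 0) n"
proof -
  have "{s::nat. s \<le> 0 \<and> 0 \<le> mu 0 + s} = {0}" by auto
  then show ?thesis
    by (simp add: jt_entry_def Lambda_scale_def jt_coeff_def)
qed

lemma jt_det_1: "jt_det b (Suc 0) mu P n = P (mu 0) n"
  by (simp add: jt_det_def det_single jt_entry_0_0)

lemma jt_det_0: "jt_det b 0 mu P n = 1"
  by (simp add: jt_det_def)

lemma det_zero_row:
  fixes f :: "nat \<Rightarrow> nat \<Rightarrow> 'a::comm_ring_1"
  assumes "k < n" "\<And>j. j < n \<Longrightarrow> f k j = 0"
  shows "det (mat n n (\<lambda>(i, j). f i j)) = 0"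
proof -
  have "mat n n (\<lambda>(i, j). f i j) = mat n n (\<lambda>(i, j). of_bool (i \<noteq> k) * 1 * f i j)"
    using assms(2) by (intro eq_matI) auto
  also have "det \<dots> = 0"
  proof -
    have "(\<Prod>i<n. of_bool (i \<noteq> k)) = (0::'a)"
      by (rule prod_zero) (use assms(1) in auto)
    then show ?thesis by (simp only: det_mat_scale mult_zero_left)
  qed
  finally show ?thesis .
qed

lemma det_zero_col:
  fixes f :: "nat \<Rightarrow> nat \<Rightarrow> 'a::comm_ring_1"
  assumes "k < n" "\<And>i. i < n \<Longrightarrow> f i k = 0"
  shows "det (mat n n (\<lambda>(i, j). f i j)) = 0"
  using det_zero_row[of k n "\<lambda>i j. f j i"] assms by (simp add: det_mat_transpose[of n f])

text \<open>\<open>det_truncate\<close> reduces to one row per part, and \<open>ndiff_gen_h\<close>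
  expands each entry.\<close>

lemma double_schur_super_h:
  assumes "length mu \<le> n" "length mu = m"
  shows "double_schur b mu n = jt_det b m (nth_default 0 mu) (super_h b) n"
proof -
  let ?mu = "nth_default 0 mu"
  define x where "x = (\<lambda>l. xvar (Suc l))"
  \<comment> \<open>\<open>det_truncate\<close> leaves these nodes free. The choice
    \<open>b 1, b 2, ...\<close> matches the formula in \<open>double_e\<close>, whose extra nodes
    \<open>a 0, a (-1), ...\<close> become these under the reflection.\<close>
  define p where "p = (\<lambda>i. newton (\<lambda>l. xconst (b (int l + 1))) i)"
  have cong: "ndiff (xnode n) g k = ndiff (\<lambda>l. x (n - Suc l)) g k" if "k < n" for g k
    using that by (intro ndiff_cong) (auto simp: x_def Suc_diff_Suc)
  have "double_schur b mu n = det (mat n n (\<lambda>(i, j).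
      ndiff (\<lambda>l. x (n - Suc l)) (newton (cnode b n) (?mu j + (n - Suc j))) (n - Suc i)))"
    unfolding double_schur_numerator(2)[OF assms(1)]
    by (intro arg_cong[of _ _ det] eq_matI) (auto simp: cong)
  also have "\<dots> = det (mat m m (\<lambda>(i, j).
      ndiff (\<lambda>l. x (n - Suc l)) (p i * newton (cnode b n) (?mu j + (n - Suc j))) (n - 1)))"
    unfolding p_def by (rule det_truncate) (use assms in \<open>auto simp: nth_default_def\<close>)
  also have "\<dots> = jt_det b m ?mu (super_h b) n"
    unfolding jt_det_def
  proof (intro arg_cong[of _ _ det] eq_matI, goal_cases)
    case (1 i j)
    then have ij: "i < m" "j < m" "j < n" "n - 1 < n"
      using assms by (auto simp: jt_det_def)
    have "ndiff (\<lambda>l. cnode b n (?mu j + (n - Suc j) + l)) (p i) s = xconst (jt_coeff b (?mu j) i j s)" for s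
    proof -
      \<comment> \<open>The number \<open>n\<close> of variables cancels, so the coefficients are
        the same in all components.\<close>
      have "(\<lambda>l. cnode b n (?mu j + (n - Suc j) + l)) = (\<lambda>l. xconst (b (1 + int j - int (?mu j) - int l)))"
        using ij(3) by (intro ext arg_cong[of _ _ xconst] arg_cong[of _ _ b]) auto
      then show ?thesis
        by (simp only: p_def jt_coeff_def xconst_hom.hom_ndiff xconst_hom.hom_newton)
    qed
    moreover have "degree (p i) \<le> i" by (simp add: p_def)
    ultimately have "ndiff (xnode n) (p i * newton (cnode b n) (?mu j + (n - Suc j))) (n - 1) =
        jt_entry b ?mu (super_h b) i j n"
      using ndiff_gen_h[OF ij(3), of "p i" i "xnode n" "cnode b n" "?mu j"]
      by (simp add: jt_entry_def Lambda_scale_def super_h_def mult.commute)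
    then show ?case
      using ij by (simp add: cong)
  qed auto
  finally show ?thesis .
qed

text \<open>The hypothesis excludes \<open>n = 0\<close>, where \<open>n - 1\<close> is truncated
  and \<open>super_h\<close> involves \<open>xvar 0\<close>.\<close>

lemma double_h_eq_super_h:
  assumes "1 \<le> n"
  shows "double_h b r n = super_h b r n"
proof (cases "r = 0")
  case True
  have "double_schur b [] n = 1"
    by (subst double_schur_super_h[of _ _ 0]) (simp_all add: jt_det_0)
  with True show ?thesis
    by (simp add: double_h_def super_h_def gen_h_def ndiff_degree_le)
next
  case False
  then show ?thesis
    using assms by (simp add: double_h_def double_schur_super_h[of _ _ "Suc 0"] jt_det_1 nth_default_def)
qed

lemma super_e_0: "super_e b 0 n = 1"
  by (simp add: super_e_def gen_e_def ndiff_degree_le)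

text \<open>Matches the coefficients of the two determinant formulas. Reflecting the polynomial and
  making it monic again costs \<open>i\<close> signs, the order of the difference \<open>s\<close>
  more.\<close>

lemma ndiff_node_reflection:
  "ndiff (\<lambda>l. a (int mu + int s - int j - int l)) (newton (\<lambda>l. a (- int l)) i) s =
    (-1) ^ (i + s) * jt_coeff (dual_seq a) mu i j s"
proof -
  define u where "u = newton (\<lambda>l. a (- int l)) i"
  have "newton (\<lambda>l. - a (- int l)) i = smult ((-1) ^ i) (pcompose u [:0, -1:])"
    unfolding u_def
  proof (induction i)
    case (Suc i)
    have "pcompose [:- a (- int i), 1:] [:0, -1:] = smult (-1) [:- (- a (- int i)), 1:]"
      by (simp add: pcompose_pCons)
    then show ?case
      by (simp only: newton_Suc pcompose_mult Suc.IH mult_smult_left mult_smult_right smult_smult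
          power_Suc mult.commute[of "-1"]) simp
  qed simp
  then have "jt_coeff (dual_seq a) mu i j s =
      (-1) ^ i * ndiff (\<lambda>l. - a (int mu - int j + int l)) (pcompose u [:0, -1:]) s"
    by (simp add: jt_coeff_def dual_seq_def ndiff_smult algebra_simps)
  also have "\<dots> = (-1) ^ (i + s) * ndiff (\<lambda>l. a (int mu - int j + int l)) u s"
    by (simp add: ndiff_reflect power_add)
  \<comment> \<open>The reflected nodes come in increasing order of index; symmetry allows the
    decreasing one.\<close>
  also have "ndiff (\<lambda>l. a (int mu - int j + int l)) u s =
      ndiff (\<lambda>l. a (int mu - int j + int (s - l))) u s"
    by (rule ndiff_rev[symmetric])
  also have "\<dots> = ndiff (\<lambda>l. a (int mu + int s - int j - int l)) u s"
    by (rule ndiff_cong) (simp add: of_nat_diff algebra_simps)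
  finally have "jt_coeff (dual_seq a) mu i j s =
      (-1) ^ (i + s) * ndiff (\<lambda>l. a (int mu + int s - int j - int l)) u s" .
  then show ?thesis
    by (simp add: u_def mult.assoc[symmetric] flip: power_mult_distrib)
qed

text \<open>\<open>det_conjugate_minor\<close> passes to the conjugate shape,
  \<open>ndiff_gen_e\<close> expands the entries, and the signs split into row and column
  factors.\<close>

lemma double_schur_super_e_ge:
  assumes lam: "is_partition lam" and n: "length lam \<le> n" and m: "\<And>i. nth_default 0 lam i \<le> m"
  shows "double_schur a lam n =
    jt_det (dual_seq a) m (conj_part n (nth_default 0 lam)) (super_e a) n"
proof -
  let ?lam = "nth_default 0 lam" and ?mu = "conj_part n (nth_default 0 lam)"
  \<comment> \<open>The variables are continued by \<open>a 0, a (-1), ...\<close>. The bialternant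
    side only sees the first \<open>n\<close> nodes; the others produce the coefficients.\<close>
  define z where "z = (\<lambda>l. if l < n then xvar (n - l) else xconst (a (int n - int l)))"
  have anti: "antimono ?lam"
  proof (rule antimonoI)
    fix i j :: nat assume "i \<le> j"
    then show "?lam j \<le> ?lam i"
      using lam by (cases "i = j") (auto simp: is_partition_def nth_default_def sorted_wrt_iff_nth_less)
  qed
  have tail: "?lam i = 0" if "n \<le> i" for i
    using that n by (simp add: nth_default_def)
  have size: "(\<Sum>j<m. ?mu j) = (\<Sum>i<n. ?lam i)"
    using maya_sign[of ?lam m n] anti m tail by blast
  have z_newton: "newton z n = newton (xnode n) n"
    by (rule newton_cong) (simp add: z_def)
  have z_tail: "newton (\<lambda>l. z (n + l)) i = map_poly xconst (newton (\<lambda>l. a (- int l)) i)" for i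
    by (simp add: z_def xconst_hom.hom_newton)
  have "double_schur a lam n = det (mat n n (\<lambda>(i, j).
      ndiff z (newton (cnode a n) (?lam j + (n - Suc j))) (n - Suc i)))"
    unfolding double_schur_numerator(2)[OF n]
    by (intro arg_cong[of _ _ det] eq_matI) (auto simp: z_def intro!: ndiff_cong)
  also have "\<dots> = det (mat n n (\<lambda>(i, j).
      ndiff z (newton (cnode a n) (?lam i + (n - Suc i))) (n - Suc j)))"
    by (rule det_mat_transpose)
  also have "\<dots> = (-1) ^ (\<Sum>i<n. ?lam i) *
      det (mat m m (\<lambda>(i, j). ndiff (cnode a n) (newton z (n + i)) (n + j - ?mu j)))"
    using anti m tail by (rule det_conjugate_minor)
  also have "mat m m (\<lambda>(i, j). ndiff (cnode a n) (newton z (n + i)) (n + j - ?mu j)) =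
      mat m m (\<lambda>(i, j). (-1) ^ i * (-1) ^ (j + ?mu j) * jt_entry (dual_seq a) ?mu (super_e a) i j n)"
  proof (intro eq_matI, goal_cases)
    case (1 i j)
    have summand: "(-1) ^ (?mu j + s - j) * gen_e (cnode a n) z n (?mu j + s - j) *
        ndiff (\<lambda>l. cnode a n (n - (?mu j + s - j) + l)) (newton (\<lambda>l. z (n + l)) i) s =
        (-1) ^ i * (-1) ^ (j + ?mu j) *
        Lambda_scale (jt_coeff (dual_seq a) (?mu j) i j s) (super_e a (?mu j + s - j)) n"
      if s: "j \<le> ?mu j + s" for s
    proof (cases "?mu j + s - j \<le> n")
      case True
      let ?r = "?mu j + s - j"
      have "(\<lambda>l. cnode a n (n - ?r + l)) =
          (\<lambda>l. xconst (a (int (?mu j) + int s - int j - int l)))"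
        using True s by (intro ext arg_cong[of _ _ xconst] arg_cong[of _ _ a]) (simp add: of_nat_diff)
      then have nd: "ndiff (\<lambda>l. cnode a n (n - ?r + l)) (newton (\<lambda>l. z (n + l)) i) s =
          (-1) ^ (i + s) * xconst (jt_coeff (dual_seq a) (?mu j) i j s)"
        unfolding z_tail
        by (simp only: xconst_hom.hom_ndiff[symmetric] ndiff_node_reflection)
          (simp add: hom_distribs xconst_hom.hom_uminus)
      have e: "gen_e (cnode a n) z n ?r = super_e a ?r n"
        by (simp add: super_e_def gen_e_def z_newton)
      \<comment> \<open>The sign of each summand does not depend on \<open>s\<close>: by parity it
        is a row sign times a column sign.\<close>
      have "?r + (i + s) + 2 * j = i + (j + ?mu j) + 2 * s"
        using s by simp
      then have "even (?r + (i + s) + 2 * j) = even (i + (j + ?mu j) + 2 * s)"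
        by (rule arg_cong)
      then have "even (?r + (i + s)) = even (i + (j + ?mu j))"
        by (simp only: even_add[of _ "2 * _"] dvd_triv_left simp_thms)
      then have "(-1) ^ (?r + (i + s)) = (-1 :: xpoly) ^ (i + (j + ?mu j))"
        by (simp only: minus_one_power_iff)
      then have sgn: "(-1) ^ ?r * (-1) ^ (i + s) = (-1 :: xpoly) ^ i * (-1) ^ (j + ?mu j)"
        by (simp only: power_add)
      have "(-1) ^ ?r * super_e a ?r n * ((-1) ^ (i + s) * xconst (jt_coeff (dual_seq a) (?mu j) i j s)) =
          ((-1) ^ ?r * (-1) ^ (i + s)) * (xconst (jt_coeff (dual_seq a) (?mu j) i j s) * super_e a ?r n)"
        by (simp only: mult_ac)
      then show ?thesis
        unfolding nd e sgn Lambda_scale_def .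
    qed (simp add: gen_e_def super_e_def Lambda_scale_def)
    have "ndiff (cnode a n) (newton z (n + i)) (n + j - ?mu j) =
        (\<Sum>s | s \<le> i \<and> j \<le> ?mu j + s. (-1) ^ i * (-1) ^ (j + ?mu j) *
        Lambda_scale (jt_coeff (dual_seq a) (?mu j) i j s) (super_e a (?mu j + s - j)) n)"
      unfolding ndiff_gen_e[OF conj_part_le] by (intro sum.cong refl summand) auto
    then show ?case
      using 1 by (simp add: jt_entry_def sum_distrib_left)
  qed auto
  also have "det \<dots> = (\<Prod>i<m. (-1) ^ i) * (\<Prod>j<m. (-1) ^ (j + ?mu j)) *
      jt_det (dual_seq a) m ?mu (super_e a) n"
    unfolding jt_det_def by (rule det_mat_scale)
  \<comment> \<open>The index signs of rows and columns cancel. What remains is the sign of the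
    complementary minor, since both shapes have the same number of boxes.\<close>
  also have "(\<Prod>i<m. (-1) ^ i) * (\<Prod>j<m. (-1) ^ (j + ?mu j)) = (-1 :: xpoly) ^ (\<Sum>i<n. ?lam i)"
    by (simp only: power_sum[symmetric] sum.distrib size)
      (simp add: power_add flip: mult.assoc power_mult_distrib)
  finally show ?thesis
    by (simp flip: mult.assoc power_mult_distrib)
qed

text \<open>A single column has parts at most 1, so \<open>m = 1\<close> is allowed and the
  determinant is its one entry; this includes \<open>r = 0\<close>.\<close>

lemma double_e_eq_super_e: "double_e a r n = super_e a r n"
proof (cases "r \<le> n")
  case True
  have "{i. i < n \<and> 0 < nth_default 0 (replicate r (1::nat)) i} = {..<r}"
    using True by (auto simp: nth_default_def)
  then have "conj_part n (nth_default 0 (replicate r 1)) 0 = r"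
    by (simp add: conj_part_def)
  moreover have "double_e a r n =
      jt_det (dual_seq a) (Suc 0) (conj_part n (nth_default 0 (replicate r 1))) (super_e a) n"
    unfolding double_e_def
    by (rule double_schur_super_e_ge)
      (use True in \<open>auto simp: is_partition_def nth_default_def sorted_wrt_iff_nth_less\<close>)
  ultimately show ?thesis by (simp only: jt_det_1)
next
  case False
  then show ?thesis
    by (simp add: double_e_def double_schur_def super_e_def gen_e_def)
qed

lemma length_conj_partition: "length (conj_partition lam) = (if lam = [] then 0 else hd lam)"
  by (simp add: conj_partition_def)

lemma partition_le_hd:
  assumes "is_partition lam"
  shows "nth_default 0 lam i \<le> length (conj_partition lam)"
proof (cases "i < length lam")
  case True
  then have "lam \<noteq> []" by auto
  with True assms show ?thesis
    by (cases i) (auto simp: length_conj_partition nth_default_def hd_conv_nth is_partition_def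
        sorted_wrt_iff_nth_less)
qed (simp add: nth_default_def)

lemma nth_default_conj_partition:
  assumes "is_partition lam" "length lam \<le> n"
  shows "nth_default 0 (conj_partition lam) = conj_part n (nth_default 0 lam)"
proof
  fix j
  have set: "{i. i < n \<and> j < nth_default 0 lam i} = {i. i < length lam \<and> j < lam ! i}"
    using assms(2) by (auto simp: nth_default_def split: if_splits)
  show "nth_default 0 (conj_partition lam) j = conj_part n (nth_default 0 lam) j"
  proof (cases "j < length (conj_partition lam)")
    case True
    moreover have "conj_part n (nth_default 0 lam) j = card {i. i < length lam \<and> j < lam ! i}"
      by (simp only: conj_part_def set)
    ultimately show ?thesis
      by (auto simp: nth_default_def conj_partition_def length_filter_conv_card
          Suc_le_eq simp del: upt_Suc)
  next
    case False
    have "\<not> j < nth_default 0 lam i" for i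
      using partition_le_hd[OF assms(1), of i] False by simp
    with False show ?thesis by (simp add: nth_default_def conj_part_def)
  qed
qed

text \<open>With fewer variables than parts, the first column only involves elementary polynomials
  of index at least \<open>length lam\<close>. These vanish, so both sides are 0.\<close>

lemma double_schur_jt_e:
  assumes "is_partition lam"
  shows "double_schur a lam =
    jt_det (dual_seq a) (length (conj_partition lam)) (nth_default 0 (conj_partition lam)) (double_e a)"
proof
  fix n
  let ?mu = "nth_default 0 (conj_partition lam)" and ?m = "length (conj_partition lam)"
  have e: "double_e a = super_e a"
    by (intro ext double_e_eq_super_e)
  show "double_schur a lam n = jt_det (dual_seq a) ?m ?mu (double_e a) n"
  proof (cases "length lam \<le> n")
    case True
    show ?thesis
      unfolding e nth_default_conj_partition[OF assms True]
      using assms True partition_le_hd[OF assms] by (rule double_schur_super_e_ge)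
  next
    case False
    then have ne: "lam \<noteq> []" by auto
    then have "hd lam \<noteq> 0"
      using assms hd_in_set[OF ne] unfolding is_partition_def by metis
    with ne have m: "0 < ?m" by (simp add: length_conj_partition)
    have "{i. i < length lam \<and> 0 < nth_default 0 lam i} = {..<length lam}"
      using assms by (auto simp: nth_default_def is_partition_def intro!: gr0I) (metis nth_mem)
    then have "?mu 0 = length lam"
      by (simp add: nth_default_conj_partition[OF assms order_refl] conj_part_def)
    then have "super_e a (?mu 0 + s - 0) n = 0" for s
      using False by (simp add: super_e_def gen_e_def)
    then have "jt_entry (dual_seq a) ?mu (double_e a) i 0 n = 0" for i
      unfolding jt_entry_def e Lambda_scale_def by simp
    with m have "jt_det (dual_seq a) ?m ?mu (double_e a) n = 0"
      unfolding jt_det_def by (intro det_zero_col) auto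
    with False show ?thesis by (simp add: double_schur_def)
  qed
qed

section \<open>Homomorphisms and determinants\<close>

lemma Lambda_carrier_iff:
  "P \<in> carrier (Lambda b) \<longleftrightarrow>
    (\<exists>d. \<forall>n. xbounded n d (P n)) \<and>
    (\<forall>n \<pi>. \<pi> permutes {1..n} \<longrightarrow> xsubst (\<lambda>i. xvar (\<pi> i)) (P n) = P n) \<and>
    (\<forall>n\<ge>1. xsubst (xvar(n := xconst (b (int n)))) (P n) = P (n - 1))"
  by (auto simp: Lambda_def symmetric_poly_def xbounded_def)

lemma Lambda_stable:
  "P \<in> carrier (Lambda b) \<Longrightarrow> 1 \<le> n \<Longrightarrow>
    xsubst (xvar(n := xconst (b (int n)))) (P n) = P (n - 1)"
  by (simp add: Lambda_carrier_iff)

lemma Lambda_ops: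
  "P \<otimes>\<^bsub>Lambda b\<^esub> Q = (\<lambda>n. P n * Q n)"
  "P \<oplus>\<^bsub>Lambda b\<^esub> Q = (\<lambda>n. P n + Q n)"
  "\<one>\<^bsub>Lambda b\<^esub> = (\<lambda>n. 1)"
  by (simp_all add: Lambda_def)

lemma Lambda_mult_closed:
  assumes "P \<in> carrier (Lambda b)" "Q \<in> carrier (Lambda b)"
  shows "(\<lambda>n. P n * Q n) \<in> carrier (Lambda b)"
proof -
  obtain d e where "\<And>n. xbounded n d (P n)" "\<And>n. xbounded n e (Q n)"
    using assms unfolding Lambda_carrier_iff by blast
  then have "\<exists>d. \<forall>n. xbounded n d (P n * Q n)"
    using xbounded_mult by blast
  then show ?thesis
    using assms unfolding Lambda_carrier_iff by (simp add: xsubst_mult)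
qed

lemma Lambda_add_closed:
  assumes "P \<in> carrier (Lambda b)" "Q \<in> carrier (Lambda b)"
  shows "(\<lambda>n. P n + Q n) \<in> carrier (Lambda b)"
proof -
  obtain d e where "\<And>n. xbounded n d (P n)" "\<And>n. xbounded n e (Q n)"
    using assms unfolding Lambda_carrier_iff by blast
  then have "\<exists>d. \<forall>n. xbounded n d (P n + Q n)"
    by (intro exI[of _ "max d e"] allI xbounded_add)
      (blast intro: xbounded_mono[OF _ max.cobounded1] xbounded_mono[OF _ max.cobounded2])+
  then show ?thesis
    using assms unfolding Lambda_carrier_iff by (simp add: xsubst_add)
qed

lemma Lambda_const_closed: "(\<lambda>n. xconst c) \<in> carrier (Lambda b)"
  unfolding Lambda_carrier_iff by (auto intro: xbounded_xconst)

lemma Lambda_scale_closed: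
  "P \<in> carrier (Lambda b) \<Longrightarrow> Lambda_scale c P \<in> carrier (Lambda b)"
  using Lambda_mult_closed[OF Lambda_const_closed[of c b], of P] by (simp add: Lambda_scale_def[abs_def])

locale Lambda_hom =
  fixes a b :: "int \<Rightarrow> qa" and \<omega> :: "(nat \<Rightarrow> xpoly) \<Rightarrow> (nat \<Rightarrow> xpoly)"
  assumes hom: "\<omega> \<in> Ring.ring_hom (Lambda a) (Lambda b)"
    and linear: "P \<in> carrier (Lambda a) \<Longrightarrow> \<omega> (Lambda_scale c P) = Lambda_scale c (\<omega> P)"
begin

lemma closed: "P \<in> carrier (Lambda a) \<Longrightarrow> \<omega> P \<in> carrier (Lambda b)"
  using hom by (rule ring_hom_closed)

lemma hom_1: "\<omega> (\<lambda>n. 1) = (\<lambda>n. 1)"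
  using ring_hom_one[OF hom] by (simp add: Lambda_ops)

lemma hom_mult:
  "P \<in> carrier (Lambda a) \<Longrightarrow> Q \<in> carrier (Lambda a) \<Longrightarrow>
    \<omega> (\<lambda>n. P n * Q n) = (\<lambda>n. \<omega> P n * \<omega> Q n)"
  using ring_hom_mult[OF hom, of P Q] by (simp add: Lambda_ops)

lemma hom_add:
  "P \<in> carrier (Lambda a) \<Longrightarrow> Q \<in> carrier (Lambda a) \<Longrightarrow>
    \<omega> (\<lambda>n. P n + Q n) = (\<lambda>n. \<omega> P n + \<omega> Q n)"
  using ring_hom_add[OF hom, of P Q] by (simp add: Lambda_ops)

lemma hom_0: "\<omega> (\<lambda>n. 0) = (\<lambda>n. 0)"
  using linear[of "\<lambda>n. 1" 0] Lambda_const_closed[of 1 a] by (simp add: Lambda_scale_def[abs_def])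

lemma hom_sum:
  assumes "\<And>i. i \<in> I \<Longrightarrow> P i \<in> carrier (Lambda a)"
  shows "(\<lambda>n. \<Sum>i\<in>I. P i n) \<in> carrier (Lambda a) \<and>
    \<omega> (\<lambda>n. \<Sum>i\<in>I. P i n) = (\<lambda>n. \<Sum>i\<in>I. \<omega> (P i) n)"
  using assms
proof (induction I rule: infinite_finite_induct)
  case (insert i I)
  then have "(\<lambda>n. \<Sum>i\<in>I. P i n) \<in> carrier (Lambda a)" "P i \<in> carrier (Lambda a)" by auto
  with insert show ?case
    by (simp add: Lambda_add_closed hom_add)
qed (use Lambda_const_closed[of 0 a] in \<open>simp_all add: hom_0\<close>)

lemma hom_prod:
  assumes "\<And>i. i \<in> I \<Longrightarrow> P i \<in> carrier (Lambda a)"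
  shows "(\<lambda>n. \<Prod>i\<in>I. P i n) \<in> carrier (Lambda a) \<and>
    \<omega> (\<lambda>n. \<Prod>i\<in>I. P i n) = (\<lambda>n. \<Prod>i\<in>I. \<omega> (P i) n)"
  using assms
proof (induction I rule: infinite_finite_induct)
  case (insert i I)
  then have "(\<lambda>n. \<Prod>i\<in>I. P i n) \<in> carrier (Lambda a)" "P i \<in> carrier (Lambda a)" by auto
  with insert show ?case
    by (simp add: Lambda_mult_closed hom_mult)
qed (use Lambda_const_closed[of 1 a] in \<open>simp_all add: hom_1\<close>)

text \<open>In the Leibniz formula the permutation signs are written as scalars, so that
  \<open>linear\<close> moves them through \<open>\<omega>\<close>.\<close>

lemma hom_det:
  assumes M: "\<And>i j. M i j \<in> carrier (Lambda a)"
  shows "(\<lambda>n. det (mat m m (\<lambda>(i, j). M i j n))) \<in> carrier (Lambda a)"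
    and "\<omega> (\<lambda>n. det (mat m m (\<lambda>(i, j). M i j n))) =
      (\<lambda>n. det (mat m m (\<lambda>(i, j). \<omega> (M i j) n)))"
proof -
  let ?S = "{p. p permutes {0..<m}}"
  define T where "T = (\<lambda>p n. \<Prod>i = 0..<m. M i (p i) n)"
  have leibniz: "det (mat m m (\<lambda>(i, j). N i j)) =
      (\<Sum>p\<in>?S. xconst (of_int (sign p)) * (\<Prod>i = 0..<m. N i (p i)))" for N :: "nat \<Rightarrow> nat \<Rightarrow> xpoly"
    by (subst det_def'[of _ m])
      (auto simp: hom_distribs permutes_in_image intro!: sum.cong prod.cong)
  have T: "T p \<in> carrier (Lambda a)" "\<omega> (T p) = (\<lambda>n. \<Prod>i = 0..<m. \<omega> (M i (p i)) n)" for p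
    unfolding T_def using hom_prod[of "{0..<m}" "\<lambda>i. M i (p i)"] M by auto
  have det: "(\<lambda>n. det (mat m m (\<lambda>(i, j). M i j n))) =
      (\<lambda>n. \<Sum>p\<in>?S. Lambda_scale (of_int (sign p)) (T p) n)"
    by (simp add: leibniz T_def Lambda_scale_def)
  note sum = hom_sum[of ?S "\<lambda>p. Lambda_scale (of_int (sign p)) (T p)"]
  show "(\<lambda>n. det (mat m m (\<lambda>(i, j). M i j n))) \<in> carrier (Lambda a)"
    unfolding det using sum T(1) by (blast intro: Lambda_scale_closed)
  have "\<omega> (\<lambda>n. det (mat m m (\<lambda>(i, j). M i j n))) =
      (\<lambda>n. \<Sum>p\<in>?S. \<omega> (Lambda_scale (of_int (sign p)) (T p)) n)"
    unfolding det using sum T(1) by (blast intro: Lambda_scale_closed)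
  then show "\<omega> (\<lambda>n. det (mat m m (\<lambda>(i, j). M i j n))) =
      (\<lambda>n. det (mat m m (\<lambda>(i, j). \<omega> (M i j) n)))"
    by (simp add: linear T leibniz Lambda_scale_def)
qed

lemma hom_jt_det:
  assumes P: "\<And>r. P r \<in> carrier (Lambda a)"
  shows "jt_det c m mu P \<in> carrier (Lambda a)"
    and "\<omega> (jt_det c m mu P) = jt_det c m mu (\<lambda>r. \<omega> (P r))"
proof -
  have entry: "jt_entry c mu P i j \<in> carrier (Lambda a)"
      "\<omega> (jt_entry c mu P i j) = jt_entry c mu (\<lambda>r. \<omega> (P r)) i j" for i j
    unfolding jt_entry_def[abs_def]
    using hom_sum[of "{s. s \<le> i \<and> j \<le> mu j + s}"
        "\<lambda>s. Lambda_scale (jt_coeff c (mu j) i j s) (P (mu j + s - j))"] P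
    by (simp_all add: Lambda_scale_closed linear)
  show "jt_det c m mu P \<in> carrier (Lambda a)"
    and "\<omega> (jt_det c m mu P) = jt_det c m mu (\<lambda>r. \<omega> (P r))"
    unfolding jt_det_def[abs_def]
    using hom_det[of "jt_entry c mu P" m] by (simp_all add: entry)
qed

end

section \<open>Components with fewer variables than parts\<close>

lemma xvar_neq_xconst: "xvar i \<noteq> xconst c"
proof
  assume *: "xvar i = xconst c"
  have "(0 :: xpoly) = xsubst (\<lambda>_. 0) (xvar i)" by simp
  also have "\<dots> = xsubst (\<lambda>_. 1) (xvar i)" by (simp add: *)
  finally show False by simp
qed

text \<open>At \<open>x\<^sub>m = b\<^sub>m\<close> the last row of the numerator vanishes.\<close>

lemma double_schur_restrict_length:
  assumes "0 < length mu" "0 \<notin> set mu"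
  shows "xsubst (xvar(length mu := xconst (b (int (length mu))))) (double_schur b mu (length mu)) = 0"
proof -
  define m where "m = length mu"
  let ?\<sigma> = "xvar(m := xconst (b (int m)))"
  let ?f = "\<lambda>i j. xpower b m (Suc i) (nth_default 0 mu j + (m - Suc j))"
  have "finite {(i, j). 1 \<le> i \<and> i < j \<and> j \<le> m}"
    by (rule finite_subset[of _ "{1..m} \<times> {1..m}"]) auto
  then have vand: "xsubst ?\<sigma> (vandermonde m) \<noteq> 0"
    by (auto simp: vandermonde_def xsubst_hom.hom_prod hom_distribs xvar_eq_iff xvar_neq_xconst)
  have "xsubst ?\<sigma> (?f (m - 1) j) = 0" if "j < m" for j
  proof -
    have "mu ! j \<noteq> 0"
      using that assms(2) nth_mem[of j mu] unfolding m_def by metis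
    then have "0 < nth_default 0 mu j + (m - Suc j)"
      using that by (simp add: m_def nth_default_def)
    then show ?thesis
      using assms(1) by (auto simp: xpower_def xsubst_hom.hom_prod hom_distribs m_def intro!: bexI[of _ 0])
  qed
  then have "det (mat m m (\<lambda>(i, j). xsubst ?\<sigma> (?f i j))) = 0"
    using assms(1) by (intro det_zero_row[of "m - 1"]) (auto simp: m_def)
  moreover have "map_mat (xsubst ?\<sigma>) (mat m m (\<lambda>(i, j). ?f i j)) =
      mat m m (\<lambda>(i, j). xsubst ?\<sigma> (?f i j))"
    by (intro eq_matI) auto
  ultimately have "xsubst ?\<sigma> (det (mat m m (\<lambda>(i, j). ?f i j))) = 0"
    by (simp only: xsubst_hom.hom_det[symmetric])
  then have "xsubst ?\<sigma> (double_schur b mu m) * xsubst ?\<sigma> (vandermonde m) = 0"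
    by (subst xsubst_mult[symmetric], subst double_schur_numerator) (simp_all add: m_def)
  with vand show ?thesis by (simp add: m_def)
qed

text \<open>Each component is a substitution instance of the next, so a zero propagates
  downwards.\<close>

lemma Lambda_vanish_below:
  assumes P: "P \<in> carrier (Lambda b)" and 0: "P k = 0" and "n \<le> k"
  shows "P n = 0"
  using \<open>n \<le> k\<close>
proof (induction n rule: inc_induct)
  case (step n)
  have "P n = xsubst (xvar(Suc n := xconst (b (int (Suc n))))) (P (Suc n))"
    using Lambda_stable[OF P, of "Suc n"] by simp
  with step show ?case by simp
qed (rule 0)

text \<open>From \<open>length mu\<close> variables on, this is \<open>double_schur_super_h\<close>.
  Below, stability of the determinant, supplied by \<open>H\<close>, reduces its vanishing to
  \<open>double_schur_restrict_length\<close>.\<close>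

lemma double_schur_jt_h:
  assumes H: "jt_det b (length mu) (nth_default 0 mu) (double_h b) \<in> carrier (Lambda b)"
    and mu: "0 \<notin> set mu"
  shows "double_schur b mu = jt_det b (length mu) (nth_default 0 mu) (double_h b)"
proof
  fix n
  let ?m = "length mu"
  let ?H = "jt_det b ?m (nth_default 0 mu) (double_h b)"
  have ge: "double_schur b mu n = ?H n" if "?m \<le> n" for n
  proof (cases "?m = 0")
    case True
    then show ?thesis
      using that by (simp add: double_schur_super_h[of _ _ 0] jt_det_0)
  next
    case False
    with that have "1 \<le> n" by linarith
    then show ?thesis
      using that by (simp add: double_schur_super_h jt_det_def jt_entry_def Lambda_scale_def double_h_eq_super_h)
  qed
  show "double_schur b mu n = ?H n"
  proof (cases "?m \<le> n")
    case False
    then have m: "0 < ?m" "n \<le> ?m - 1" by auto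
    have "?H (?m - 1) = xsubst (xvar(?m := xconst (b (int ?m)))) (?H ?m)"
      using m(1) by (intro Lambda_stable[OF H, symmetric]) linarith
    also have "\<dots> = 0"
      using double_schur_restrict_length[OF m(1) mu, of b] by (simp only: ge[OF order_refl])
    finally have "?H n = 0"
      by (rule Lambda_vanish_below[OF H _ m(2)])
    with False show ?thesis by (simp add: double_schur_def)
  qed (rule ge)
qed

lemma zero_notin_conj_partition:
  assumes "is_partition lam"
  shows "0 \<notin> set (conj_partition lam)"
proof -
  have "filter (\<lambda>p. j \<le> p) lam \<noteq> []" if "lam \<noteq> []" "j \<le> hd lam" for j
    using that by (cases lam) auto
  then show ?thesis
    by (auto simp: conj_partition_def simp del: upt_Suc split: if_splits)
qed

theorem corollary2p7:
  fixes \<omega> :: "(nat \<Rightarrow> xpoly) \<Rightarrow> (nat \<Rightarrow> xpoly)"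
  assumes iso: "\<omega> \<in> ring_iso (Lambda avar) (Lambda (dual_seq avar))"
    and linear: "\<And>c P. P \<in> carrier (Lambda avar) \<Longrightarrow>
                   \<omega> (Lambda_scale c P) = Lambda_scale c (\<omega> P)"
    and generators: "\<And>k. k \<ge> 1 \<Longrightarrow> \<omega> (double_e avar k) = double_h (dual_seq avar) k"
    and partition: "is_partition lam"
  shows "\<omega> (double_schur avar lam) = double_schur (dual_seq avar) (conj_partition lam)"
proof -
  interpret Lambda_hom avar "dual_seq avar" \<omega>
    using iso linear by unfold_locales (auto simp: ring_iso_def)
  let ?b = "dual_seq avar" and ?mu = "conj_partition lam"
  have e: "double_e avar r \<in> carrier (Lambda avar)" for r
    using super_e_in_Lambda[of avar r] by (simp add: double_e_eq_super_e[abs_def])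
  \<comment> \<open>Index 0 also occurs in the entries of the determinant; both polynomials are then
    1.\<close>
  have "\<omega> (double_e avar r) = double_h ?b r" for r
  proof (cases "r = 0")
    case True
    have "double_e avar 0 = (\<lambda>n. 1)"
      by (rule ext) (simp add: double_e_eq_super_e super_e_0)
    moreover have "double_h ?b 0 = (\<lambda>n. 1)"
      by (rule ext) (simp add: double_h_def double_schur_super_h[of _ _ 0] jt_det_0)
    ultimately show ?thesis using True hom_1 by simp
  qed (use generators in simp)
  then have \<omega>: "\<omega> (double_schur avar lam) = jt_det ?b (length ?mu) (nth_default 0 ?mu) (double_h ?b)"
    unfolding double_schur_jt_e[OF partition] hom_jt_det(2)[OF e] by simp
  \<comment> \<open>As an image under \<open>\<omega>\<close>, the determinant in
    \<open>double_h\<close> lies in \<open>Lambda ?b\<close>; this is the membership that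
    \<open>double_schur_jt_h\<close> requires.\<close>
  moreover have "\<omega> (double_schur avar lam) \<in> carrier (Lambda ?b)"
    unfolding double_schur_jt_e[OF partition] by (intro closed hom_jt_det(1) e)
  ultimately show ?thesis
    using double_schur_jt_h[OF _ zero_notin_conj_partition[OF partition]] by simp
qed

end
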